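(* Given a tree $S\subseteq\mathrm{ds}(\infty)$, $n( * )<\omega$ and a cardinal $\mu$, there is a tree $T\subseteq\mathrm{ds}(\infty)$ such that: $( * )_1$ for every $c:[T]^{<\aleph_0}\to\mu$ there is a subtree $S'\subseteq T$ isomorphic to $S$ such that $S'$ is $n( * )$-end-uniform for $c$; $( * )_2$ in particular, for every $c:[T]^{n( * )}\to\mu$ there is a subtree $S'\subseteq T$ isomorphic to $S$ such that $c\restriction[S']^{n( * )}$ depends only on the similarity class, i.e. $c(u_1)=c(u_2)$ whenever $u_1,u_2\in[S']^{n( * )}$ are similar; $( * )_3$ $|T|<\beth_{1,n( * )}(|S|,\mu)$.
   Context: $\mathrm{ds}(\infty)$ is the class of finite (strictly) decreasing sequences of ordinals. For a sequence $\eta$, $\mathrm{lg}(\eta)$ is its length; $\eta\triangleleft\nu$ means $\eta$ is a proper initial segment of $\nu$; $\eta\cap\nu$ is the longest common initial segment $\eta\restriction\ell$ ($\ell$ maximal with $\eta\restriction\ell=\nu\restriction\ell$). A tree is a non-empty $T\subseteq\mathrm{ds}(\infty)$ closed under initial segments; a subtree of $T$ is a tree contained in $T$. Orders on $\mathrm{ds}(\infty)$: $\eta<^1_{\ell x}\nu$ iff $\eta\triangleleft\nu$ or there is $\ell<\min(\mathrm{lg}(\eta),\mathrm{lg}(\nu))$ with $\eta\restriction\ell=\nu\restriction\ell$ and $\eta(\ell)<\nu(\ell)$. $\eta<^2_{\ell x}\nu$ iff $\nu\triangleleft\eta$ or there is such an $\ell$ with $\eta\restriction\ell=\nu\restriction\ell$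 and $\eta(\ell)<\nu(\ell)$. Both are linear orders. An embedding of a tree $T_1$ into a tree $T_2$ is a map $f:T_1\to T_2$ preserving level (length), $\triangleleft$ and $<^1_{\ell x}$ (equivalently $<^2_{\ell x}$). Trees are isomorphic if there is an embedding of one onto the other. Two finite sequences $\langle\eta_\ell:\ell<n\rangle$, $\langle\nu_\ell:\ell<n\rangle$ of elements of $\mathrm{ds}(\infty)$ are similar when, for all $\ell,m<n$: $\mathrm{lg}(\eta_\ell)=\mathrm{lg}(\nu_\ell)$; $\mathrm{lg}(\eta_\ell\cap\eta_m)=\mathrm{lg}(\nu_\ell\cap\nu_m)$; and $\eta_\ell<^2_{\ell x}\eta_m$ iff $\nu_\ell<^2_{\ell x}\nu_m$. A finite set $u\subseteq T$ is identified with the $<^2_{\ell x}$-increasing sequence listing it. $[T]^{<\aleph_0}$ is the set of finite subsets of $T$ and $[T]^n$ the set of $n$-element subsets. A tree $T$ is $n$-end-uniform for $c$ (where $c$ is defined on $[T]^{<\aleph_0}$, or on the finite subsets of a larger tree) if: whenever $k<\omega$ and $\eta_i,\rho'_j,\rho''_j\in T$ ($0<i\le k$, $0<j\le n$) satisfy $\eta_1<^2_{\ell x}\dots<^2_{\ell x}\eta_k<^2_{\ell x}\rho'_1<^2_{\ell x}\dots<^2_{\ell x}\rho'_n$ and $\eta_1<^2_{\ell x}\dots<^2_{\ell x}\eta_k<^2_{\ell x}\rho''_1<^2_{\ell x}\dots<^2_{\ell x}\rho''_n$, and these two sequences are similar, then $c(\langle\eta_1,\dots,\eta_k,\rho'_1,\dots,\rho'_n\rangle)=c(\langle\eta_1,\dots,\eta_k,\rho''_1,\dots,\rho''_n\rangle)$.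 For a cardinal $\kappa$: $\beth_0(\kappa)=\kappa$, $\beth_{\alpha+1}(\kappa)=2^{\beth_\alpha(\kappa)}$, $\beth_\delta(\kappa)=\sup_{\alpha<\delta}\beth_\alpha(\kappa)$ for limit $\delta$. For cardinals $\lambda\ge\aleph_0$ and $\mu$: $\beth_{1,0}(\lambda,\mu)=\lambda$, $\beth_{1,\alpha+1}(\lambda,\mu)=\beth_{\beth_{1,\alpha}(\lambda,\mu)^+}(\beth_{1,\alpha}(\lambda,\mu)+\mu)$, and $\beth_{1,\alpha}(\lambda,\mu)=\sum_{\beta<\alpha}\beth_{1,\beta}(\lambda,\mu)$ for limit $\alpha$.
   Formalization: The bound ( * )_3 is claimed only for n( * )>0, since for n( * )=0 it would say |T|<|S| although T contains a copy of S; for finite S, where ℶ_{1,n} is undefined, |S| in ( * )_3 is replaced by max(|S|,ℵ_0). *)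

theory Defs
  imports "HOL-Library.Equipollence" "HOL-Library.FuncSet" "HOL-Library.Ramsey" "HOL-Library.Sublist"
begin

section \<open>Ordinals and cardinals\<close>

text \<open>
  HOL has no type of all ordinals. A type of class \<open>ordinals\<close> stands for the ordinals below
  some bound: any uncountable well-order that is closed under \<open>(\<kappa>, \<alpha>) \<mapsto> \<beth>\<^sub>\<alpha>(\<kappa>)\<close>. The last
  axiom says so without reference to the beth function, by asking for a chain of length \<open>\<alpha> + 1\<close>
  starting above \<open>\<kappa>\<close> in which every term is at least the power of each earlier one. ZFC proves
  both axioms for the class of all ordinals and for arbitrarily large ordinals (the uncountable
  fixed points of beth); regularity, hence an inaccessible cardinal, is not required.
  As usual the ordinal \<open>\<alpha>\<close> is the set \<open>{..<\<alpha>}\<close> of its predecessors, and cardinals are initial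
  ordinals.
\<close>

class ordinals = wellorder +
  assumes ex_infinite: "\<exists>\<alpha>. infinite {..<\<alpha>}"
    and ex_power_chain:
      "\<exists>f. \<forall>\<beta>\<le>\<alpha>. \<kappa> \<le> f \<beta> \<and> (\<forall>\<gamma><\<beta>. Pow {..<f \<gamma>} \<lesssim> {..<f \<beta>})"

text \<open>The subclasses of the ordinals, of sequences of ordinals etc. that are sets.\<close>

definition small :: "'o::ordinals itself \<Rightarrow> 'b set \<Rightarrow> bool" where
  "small _ A \<longleftrightarrow> (\<exists>\<alpha>::'o. A \<lesssim> {..<\<alpha>})"

definition is_cardinal :: "'o::ordinals \<Rightarrow> bool" where
  "is_cardinal \<kappa> \<longleftrightarrow> (\<forall>\<alpha><\<kappa>. {..<\<alpha>} \<prec> {..<\<kappa>})"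

definition ocard :: "'b set \<Rightarrow> 'o::ordinals" where
  "ocard A = (LEAST \<alpha>. A \<approx> {..<\<alpha>})"

definition aleph0 :: "'o::ordinals" where
  "aleph0 = ocard (UNIV :: nat set)"

definition osuc :: "'o::ordinals \<Rightarrow> 'o" where
  "osuc \<alpha> = (LEAST \<beta>. \<alpha> < \<beta>)"

definition osup :: "'o::ordinals set \<Rightarrow> 'o" where
  "osup A = (LEAST \<beta>. \<forall>\<alpha>\<in>A. \<alpha> \<le> \<beta>)"

definition csucc :: "'o::ordinals \<Rightarrow> 'o" where
  "csucc \<kappa> = (LEAST \<alpha>. {..<\<kappa>} \<prec> {..<\<alpha>})"

definition cadd :: "'o::ordinals \<Rightarrow> 'o \<Rightarrow> 'o" where
  "cadd \<kappa> \<mu> = ocard ({..<\<kappa>} <+> {..<\<mu>})"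

definition cpow2 :: "'o::ordinals \<Rightarrow> 'o" where
  "cpow2 \<kappa> = ocard (Pow {..<\<kappa>})"

lemma lessThan_lepoll_mono:
  fixes \<alpha> \<beta> :: "'o::ordinals"
  assumes "\<alpha> \<le> \<beta>"
  shows "{..<\<alpha>} \<lesssim> {..<\<beta>}"
  using assms by (intro subset_imp_lepoll) auto

lemma less_if_Pow_lepoll:
  fixes \<alpha> \<beta> :: "'o::ordinals"
  assumes "Pow {..<\<alpha>} \<lesssim> {..<\<beta>}"
  shows "\<alpha> < \<beta>"
proof (rule ccontr)
  assume "\<not> \<alpha> < \<beta>"
  then have "{..<\<beta>} \<lesssim> {..<\<alpha>}" by (intro lessThan_lepoll_mono) auto
  with assms have "Pow {..<\<alpha>} \<lesssim> {..<\<alpha>}" by (rule lepoll_trans)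
  then show False
    using lesspoll_Pow_self lesspoll_def lepoll_antisym by blast
qed

lemma ex_Pow_lepoll: "\<exists>\<beta>>\<kappa>. Pow {..<\<kappa>} \<lesssim> {..<\<beta>}" for \<kappa> :: "'o::ordinals"
proof -
  obtain \<alpha> :: 'o where "infinite {..<\<alpha>}" using ex_infinite by blast
  then obtain \<gamma> where "\<gamma> < \<alpha>" by (metis finite.emptyI lessThan_iff ex_in_conv)
  moreover obtain f where f: "\<forall>\<beta>\<le>\<alpha>. \<kappa> \<le> f \<beta> \<and> (\<forall>\<gamma><\<beta>. Pow {..<f \<gamma>} \<lesssim> {..<f \<beta>})"
    using ex_power_chain[of \<alpha> \<kappa>] by blast
  ultimately have "\<kappa> \<le> f \<gamma>" "Pow {..<f \<gamma>} \<lesssim> {..<f \<alpha>}" by auto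
  moreover have "Pow {..<\<kappa>} \<lesssim> Pow {..<f \<gamma>}"
    using \<open>\<kappa> \<le> f \<gamma>\<close> by (intro subset_imp_lepoll Pow_mono) auto
  ultimately show ?thesis
    using less_if_Pow_lepoll lepoll_trans by blast
qed

lemma less_osuc: "\<alpha> < osuc \<alpha>"
  unfolding osuc_def by (rule LeastI_ex) (use ex_Pow_lepoll in blast)

lemma osuc_le_iff: "osuc \<alpha> \<le> \<beta> \<longleftrightarrow> \<alpha> < \<beta>"
  unfolding osuc_def
  by (metis Least_le less_osuc order_less_le_trans osuc_def)

lemma osuc_inject: "osuc \<alpha> = osuc \<beta> \<longleftrightarrow> \<alpha> = \<beta>"
  by (metis less_osuc linorder_neqE not_le osuc_le_iff)

lemma the_osuc: "(THE \<gamma>. osuc \<beta> = osuc \<gamma>) = \<beta>"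
  by (auto simp: osuc_inject)

text \<open>The beth function \<open>\<beth>\<^sub>\<alpha>(\<kappa>)\<close>, by recursion on \<open>\<alpha>\<close>.\<close>

function beth :: "'o::ordinals \<Rightarrow> 'o \<Rightarrow> 'o" where
  "beth \<alpha> \<kappa> =
     (if \<forall>\<beta>. \<alpha> \<le> \<beta> then \<kappa>
      else if \<exists>\<beta>. \<alpha> = osuc \<beta> then cpow2 (beth (THE \<beta>. \<alpha> = osuc \<beta>) \<kappa>)
      else osup ((\<lambda>\<beta>. beth \<beta> \<kappa>) ` {..<\<alpha>}))"
  by auto
termination
proof (relation "inv_image {(\<alpha>, \<beta>). \<alpha> < \<beta>} fst")
  show "wf (inv_image {(\<alpha>::'a::ordinals, \<beta>). \<alpha> < \<beta>} fst)" by (intro wf_inv_image wf)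
qed (use less_osuc in \<open>auto simp: the_osuc\<close>)

declare beth.simps [simp del]

text \<open>
  \<open>\<beth>\<^bsub>1,n\<^esub>(\<kappa>, \<mu>)\<close> for finite \<open>n\<close> and \<open>\<kappa> \<ge> \<aleph>\<^sub>0\<close>. (The limit stages, which lead beyond the first
  fixed point of beth, are not needed.)
\<close>

primrec beth1 :: "nat \<Rightarrow> 'o::ordinals \<Rightarrow> 'o \<Rightarrow> 'o" where
  "beth1 0 \<kappa> \<mu> = \<kappa>"
| "beth1 (Suc n) \<kappa> \<mu> = beth (csucc (beth1 n \<kappa> \<mu>)) (cadd (beth1 n \<kappa> \<mu>) \<mu>)"

text \<open>
  The cardinals above are all defined by \<open>LEAST\<close>; the following facts confirm that the ordinals
  in question exist and that the recursion equations of beth hold.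
\<close>

lemma lepoll_lessThan_imp_eqpoll:
  fixes \<alpha> :: "'o::ordinals"
  assumes "A \<lesssim> {..<\<alpha>}"
  shows "\<exists>\<beta>\<le>\<alpha>. A \<approx> {..<\<beta>}"
proof -
  define R where "R = {(x, y). x \<le> y \<and> y < \<alpha>}"
  have Field: "Field R = {..<\<alpha>}"
    by (auto simp: R_def Field_def)
  have "wf (R - Id)"
    by (rule wf_subset[OF wf]) (auto simp: R_def)
  then have R: "Well_order R" "well_order_on {..<\<alpha>} R"
    unfolding well_order_on_def linear_order_on_def partial_order_on_def preorder_on_def Field
    by (auto simp: R_def refl_on_def trans_def antisym_def total_on_def)
  obtain f where f: "inj_on f A" "f ` A \<subseteq> {..<\<alpha>}"
    using assms unfolding lepoll_def by blast
  then have "ordLeq3 (card_of A) (card_of {..<\<alpha>})"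
    using card_of_ordLeq by blast
  also have "ordLeq3 (card_of {..<\<alpha>}) R"
    using R by (intro card_of_least)
  finally consider "ordIso2 (card_of A) R" | "ordLess2 (card_of A) R"
    using ordLeq_iff_ordLess_or_ordIso by blast
  then show ?thesis
  proof cases
    case 1
    then obtain g where "iso (card_of A) R g" unfolding ordIso_def by blast
    then have "bij_betw g A {..<\<alpha>}" by (simp add: iso_def Field Field_card_of)
    then show ?thesis unfolding eqpoll_def by blast
  next
    case 2
    then obtain a where a: "a < \<alpha>" "ordIso2 (card_of A) (Restr R (underS R a))"
      using ordLess_iff_ordIso_Restr[OF R(1) card_of_Well_order] Field by auto
    have "underS R a = {..<a}"
      using a(1) by (auto simp: underS_def R_def)
    moreover have "Field (Restr R {..<a}) = {..<a}"
      using a(1) by (auto simp: R_def Field_def)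
    ultimately obtain g where "iso (card_of A) (Restr R {..<a}) g" "Field (Restr R {..<a}) = {..<a}"
      using a(2) unfolding ordIso_def by auto
    then have "bij_betw g A {..<a}" by (simp add: iso_def Field_card_of)
    then show ?thesis using a(1) unfolding eqpoll_def by (meson less_imp_le)
  qed
qed

lemma eqpoll_ocard:
  assumes "A \<lesssim> {..<\<alpha>::'o::ordinals}"
  shows "A \<approx> {..<ocard A :: 'o}" "(ocard A :: 'o) \<le> \<alpha>"
proof -
  obtain \<beta> where "\<beta> \<le> \<alpha>" "A \<approx> {..<\<beta>}"
    using lepoll_lessThan_imp_eqpoll[OF assms] by blast
  then show "A \<approx> {..<ocard A :: 'o}" "(ocard A :: 'o) \<le> \<alpha>"
    unfolding ocard_def by (auto intro: LeastI Least_le order_trans)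
qed

lemma cpow2_le: "Pow {..<\<kappa>} \<lesssim> {..<\<alpha>} \<Longrightarrow> cpow2 \<kappa> \<le> \<alpha>"
  and eqpoll_cpow2: "Pow {..<\<kappa>} \<approx> {..<cpow2 \<kappa>}"
  using eqpoll_ocard ex_Pow_lepoll[of \<kappa>] unfolding cpow2_def by blast+

lemma lesspoll_csucc: "{..<\<kappa>} \<prec> {..<csucc \<kappa>}"
  unfolding csucc_def
  by (rule LeastI_ex) (use ex_Pow_lepoll[of \<kappa>] lesspoll_Pow_self lesspoll_trans2 in blast)

lemma small_nat: "small TYPE('o::ordinals) (UNIV :: nat set)"
  using ex_infinite by (auto simp: small_def infinite_le_lepoll)

lemma beth_zero: "(\<And>\<beta>. \<alpha> \<le> \<beta>) \<Longrightarrow> beth \<alpha> \<kappa> = \<kappa>"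
  by (simp add: beth.simps)

lemma beth_osuc: "beth (osuc \<alpha>) \<kappa> = cpow2 (beth \<alpha> \<kappa>)"
  using less_osuc[of \<alpha>] by (subst beth.simps) (auto simp: the_osuc simp flip: not_less)

lemma beth_limit:
  assumes "\<beta> < \<alpha>" "\<And>\<gamma>. \<alpha> \<noteq> osuc \<gamma>"
  shows "beth \<alpha> \<kappa> = osup ((\<lambda>\<beta>. beth \<beta> \<kappa>) ` {..<\<alpha>})"
  using assms by (subst beth.simps) (auto simp flip: not_less)

lemma bdd_above_beth: "\<exists>\<delta>. \<forall>\<beta>\<le>\<alpha>. beth \<beta> \<kappa> \<le> \<delta>"
proof -
  obtain f where f: "\<forall>\<beta>\<le>\<alpha>. \<kappa> \<le> f \<beta> \<and> (\<forall>\<gamma><\<beta>. Pow {..<f \<gamma>} \<lesssim> {..<f \<beta>})"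
    using ex_power_chain[of \<alpha> \<kappa>] by blast
  have mono: "f \<gamma> \<le> f \<beta>" if "\<gamma> \<le> \<beta>" "\<beta> \<le> \<alpha>" for \<gamma> \<beta>
    using that f less_if_Pow_lepoll[of "f \<gamma>" "f \<beta>"] by (cases "\<gamma> = \<beta>") (auto simp: less_imp_le)
  have "beth \<beta> \<kappa> \<le> f \<beta>" if "\<beta> \<le> \<alpha>" for \<beta>
    using that
  proof (induction \<beta> rule: less_induct)
    case (less \<beta>)
    consider "\<forall>\<gamma>. \<beta> \<le> \<gamma>" | \<gamma> where "\<beta> = osuc \<gamma>" | \<gamma> where "\<gamma> < \<beta>" "\<And>\<gamma>. \<beta> \<noteq> osuc \<gamma>"
      by (meson not_le)
    then show ?case
    proof cases
      case 1
      then show ?thesis using f less.prems by (simp add: beth_zero)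
    next
      case 2
      then have "\<gamma> < \<beta>" by (simp add: less_osuc)
      then have "beth \<gamma> \<kappa> \<le> f \<gamma>" "Pow {..<f \<gamma>} \<lesssim> {..<f \<beta>}"
        using less f by auto
      moreover from calculation have "Pow {..<beth \<gamma> \<kappa>} \<lesssim> Pow {..<f \<gamma>}"
        by (intro subset_imp_lepoll Pow_mono) auto
      ultimately show ?thesis
        unfolding 2 beth_osuc using lepoll_trans by (blast intro: cpow2_le)
    next
      case 3
      have "\<forall>\<gamma>\<in>(\<lambda>\<beta>. beth \<beta> \<kappa>) ` {..<\<beta>}. \<gamma> \<le> f \<beta>"
        using less mono by (auto intro: order_trans[OF less.IH mono])
      then show ?thesis
        unfolding beth_limit[OF 3] osup_def by (rule Least_le)
    qed
  qed
  then show ?thesis using mono order_trans by blast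
qed


section \<open>Trees of decreasing sequences\<close>

definition ds :: "'o::ordinals list set" where
  "ds = {\<eta>. sorted_wrt (>) \<eta>}"

definition lx_split :: "'o::ordinals list \<Rightarrow> 'o list \<Rightarrow> bool" where
  "lx_split \<eta> \<nu> \<longleftrightarrow>
     (\<exists>l < min (length \<eta>) (length \<nu>). take l \<eta> = take l \<nu> \<and> \<eta> ! l < \<nu> ! l)"

definition lx1 :: "'o::ordinals list \<Rightarrow> 'o list \<Rightarrow> bool" where
  "lx1 \<eta> \<nu> \<longleftrightarrow> strict_prefix \<eta> \<nu> \<or> lx_split \<eta> \<nu>"

definition lx2 :: "'o::ordinals list \<Rightarrow> 'o list \<Rightarrow> bool" where
  "lx2 \<eta> \<nu> \<longleftrightarrow> strict_prefix \<nu> \<eta> \<or> lx_split \<eta> \<nu>"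

text \<open>Trees are sets rather than proper classes of sequences, hence the smallness condition.\<close>

definition tree :: "'o::ordinals list set \<Rightarrow> bool" where
  "tree T \<longleftrightarrow> small TYPE('o) T \<and> T \<noteq> {} \<and> T \<subseteq> ds \<and> (\<forall>\<eta>\<in>T. \<forall>\<nu>. prefix \<nu> \<eta> \<longrightarrow> \<nu> \<in> T)"

definition subtree :: "'o::ordinals list set \<Rightarrow> 'o list set \<Rightarrow> bool" where
  "subtree S T \<longleftrightarrow> tree S \<and> S \<subseteq> T"

definition tree_embedding ::
    "('o::ordinals list \<Rightarrow> 'o list) \<Rightarrow> 'o list set \<Rightarrow> 'o list set \<Rightarrow> bool" where
  "tree_embedding f T\<^sub>1 T\<^sub>2 \<longleftrightarrow>
     f ` T\<^sub>1 \<subseteq> T\<^sub>2 \<and>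
     (\<forall>\<eta>\<in>T\<^sub>1. length (f \<eta>) = length \<eta>) \<and>
     (\<forall>\<eta>\<in>T\<^sub>1. \<forall>\<nu>\<in>T\<^sub>1. strict_prefix \<eta> \<nu> \<longrightarrow> strict_prefix (f \<eta>) (f \<nu>)) \<and>
     (\<forall>\<eta>\<in>T\<^sub>1. \<forall>\<nu>\<in>T\<^sub>1. lx1 \<eta> \<nu> \<longrightarrow> lx1 (f \<eta>) (f \<nu>))"

definition tree_isomorphic :: "'o::ordinals list set \<Rightarrow> 'o list set \<Rightarrow> bool" where
  "tree_isomorphic T\<^sub>1 T\<^sub>2 \<longleftrightarrow> (\<exists>f. tree_embedding f T\<^sub>1 T\<^sub>2 \<and> f ` T\<^sub>1 = T\<^sub>2)"

definition similar :: "'o::ordinals list list \<Rightarrow> 'o list list \<Rightarrow> bool" where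
  "similar \<eta>s \<nu>s \<longleftrightarrow>
     length \<eta>s = length \<nu>s \<and>
     (\<forall>l < length \<eta>s. \<forall>m < length \<eta>s.
        length (\<eta>s ! l) = length (\<nu>s ! l) \<and>
        length (longest_common_prefix (\<eta>s ! l) (\<eta>s ! m)) =
          length (longest_common_prefix (\<nu>s ! l) (\<nu>s ! m)) \<and>
        (lx2 (\<eta>s ! l) (\<eta>s ! m) \<longleftrightarrow> lx2 (\<nu>s ! l) (\<nu>s ! m)))"

text \<open>
  A finite set of sequences is identified with its \<open>lx2\<close>-increasing listing. So colourings are
  functions on finite sets: \<open>c\<close> applied to an increasing sequence is \<open>c\<close> applied to its range,
  and two sets are similar if their listings are.
\<close>

definition lx2_list :: "'o::ordinals list set \<Rightarrow> 'o list list" where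
  "lx2_list u = (THE \<eta>s. sorted_wrt lx2 \<eta>s \<and> set \<eta>s = u)"

definition similar_sets :: "'o::ordinals list set \<Rightarrow> 'o list set \<Rightarrow> bool" where
  "similar_sets u v \<longleftrightarrow> similar (lx2_list u) (lx2_list v)"

definition end_uniform :: "nat \<Rightarrow> ('o::ordinals list set \<Rightarrow> 'c) \<Rightarrow> 'o list set \<Rightarrow> bool" where
  "end_uniform n c T \<longleftrightarrow>
     (\<forall>\<eta>s \<rho>s \<rho>s'.
        set \<eta>s \<subseteq> T \<and> set \<rho>s \<subseteq> T \<and> set \<rho>s' \<subseteq> T \<and>
        length \<rho>s = n \<and> length \<rho>s' = n \<and>
        sorted_wrt lx2 (\<eta>s @ \<rho>s) \<and> sorted_wrt lx2 (\<eta>s @ \<rho>s') \<and>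
        similar (\<eta>s @ \<rho>s) (\<eta>s @ \<rho>s')
        \<longrightarrow> c (set (\<eta>s @ \<rho>s)) = c (set (\<eta>s @ \<rho>s')))"

end

theory Submission
  imports Defs
begin

text \<open>
  The order \<open>lx2\<close> lists a tree in postorder: children from left to right, then their parent. Call
  a copy \<open>f\<close> of \<open>S\<close> in \<open>T\<close> tail-uniform for \<open>c\<close> if the colour of \<open>f ` u \<union> {f \<rho>}\<close>, where \<open>\<rho>\<close> comes after
  the finite set \<open>u\<close>, depends only on \<open>u\<close>, on the length of \<open>\<rho>\<close> and on the level at which \<open>\<rho>\<close> branches
  off from the last element of \<open>u\<close>. The theorem follows by iterating the case of one end element.

  The iteration (\<open>end_uniform_Suc\<close>, \<open>ex_end_uniform_tree\<close>). Let \<open>T0\<close> serve \<open>S\<close> for \<open>n\<close>, and let \<open>T\<close>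
  contain a tail-uniform copy \<open>h\<close> of \<open>T0\<close> for each colouring. A colouring \<open>c\<close> of \<open>T\<close> induces a colouring of
  \<open>T0\<close>: the colour of \<open>u\<close> is the function that maps a way of adding an element at the end of \<open>u\<close> to
  the colour under \<open>c\<close> that results. A copy of \<open>S\<close> in \<open>T0\<close> that is \<open>n\<close>-end-uniform for the induced
  colouring becomes \<open>(n + 1)\<close>-end-uniform for \<open>c\<close> after applying \<open>h\<close>. There are countably many ways
  of adding an element, so all the time \<open>2\<^bsup>\<mu> + \<omega>\<^esup>\<close> colours are allowed, a number that is stable under
  countable powers.

  One end element (\<open>ex_tail_uniform_copy\<close>). Here \<open>T\<close> consists of all decreasing sequences below
  \<open>\<chi>\<^sup>+\<^sup>+\<close>, where \<open>\<chi>\<close> is \<open>\<beth>\<^sub>\<omega>\<close> of the cardinals given; a few more powers bound the size of \<open>T\<close>, and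
  this is far below \<open>\<beth>\<^bsub>\<theta>\<^sup>+\<^esub>\<close>. A promise assigns to certain finite sets \<open>b\<close> and levels \<open>l\<close> a
  colour; a copy of the part of \<open>S\<close> above a node keeps it if \<open>b \<union> {f \<rho>}\<close> has the promised colour
  whenever \<open>\<rho>\<close> has length \<open>l\<close>. If the subtrees at the children of \<open>\<sigma>\<close> are copied from left to right above
  increasing children of \<open>\<tau>\<close>, each copy keeping one and the same promise about the sets formed from
  the earlier copies, the union is tail-uniform (\<open>good_copy_glue\<close>). As in the Erdos-Rado theorem,
  such copies exist by reflection from a single child \<open>\<tau> @ [x]\<close> (\<open>copies_extend\<close>): fix canonical
  choices for the copies, one system of choices for each promise. If above \<open>\<tau> @ [x]\<close> every
  subtree at a child of \<open>\<sigma>\<close> has a copy that keeps a promise about all sets that occur in any of these systems,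
  then this copy shows that the system for that promise never gets stuck. One level costs one power set, since
  there are that many promises.

  Iterating this down \<open>T\<close> would need an infinite branch if all levels of \<open>S\<close> are to be treated at
  once, and \<open>T\<close> has none. Instead, the nodes of each level are classified by a type, which records
  what the argument uses: colours and promises that can be kept. There are at most \<open>\<chi>\<close> types,
  whereas the last entries of the nodes range over \<open>\<chi>\<^sup>+\<^sup>+\<close>. So by the pigeonhole principle there is an
  infinite sequence of types, each occurring at nodes with arbitrarily large last entry and linked
  to the next one by \<open>copies_extend\<close> (\<open>big_extend\<close>). The colours recorded in this sequence define
  one promise \<open>g\<close>, and induction from the leaves of \<open>S\<close> to its root shows that it can
  be kept at every level.
\<close>


section \<open>Sizes of sets\<close>

lemma Times_lepoll:
  assumes "infinite K" "A \<lesssim> K" "B \<lesssim> K"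
  shows "A \<times> B \<lesssim> K"
proof -
  have "K \<times> K \<approx> K"
    using card_of_Times_same_infinite[OF assms(1)] by (simp add: eqpoll_iff_card_of_ordIso)
  then show ?thesis
    using times_lepoll_mono[OF assms(2,3)] lepoll_trans2 by blast
qed

lemma UN_lepoll:
  assumes "infinite K" "A \<lesssim> K" "\<And>a. a \<in> A \<Longrightarrow> f a \<lesssim> K"
  shows "(\<Union>a\<in>A. f a) \<lesssim> K"
proof -
  have "(\<Union>a\<in>A. f a) = snd ` Sigma A f" by force
  also have "\<dots> \<lesssim> Sigma A f" by (rule image_lepoll)
  also have "\<dots> \<lesssim> A \<times> K" using assms(3) by (intro Sigma_lepoll_mono) auto
  also have "\<dots> \<lesssim> K" using assms by (intro Times_lepoll) auto
  finally show ?thesis .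
qed

lemma Un_lepoll:
  assumes "infinite K" "A \<lesssim> K" "B \<lesssim> K"
  shows "A \<union> B \<lesssim> K"
proof -
  have "(\<Union>b\<in>{True, False}. if b then A else B) \<lesssim> K"
    using assms by (intro UN_lepoll) (auto intro: finite_lepoll_infinite)
  then show ?thesis by (simp add: Un_commute)
qed

lemma insert_lepoll: "infinite K \<Longrightarrow> A \<lesssim> K \<Longrightarrow> insert a A \<lesssim> K"
  using Un_lepoll[of K "{a}" A] by (simp add: finite_lepoll_infinite)

lemma Pow_lepoll_mono:
  assumes "A \<lesssim> B" shows "Pow A \<lesssim> Pow B"
proof -
  obtain f where f: "inj_on f A" "f ` A \<subseteq> B"
    using assms unfolding lepoll_def by blast
  then have "inj_on ((`) f) (Pow A)" "(`) f ` Pow A \<subseteq> Pow B"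
    by (auto simp: inj_on_image_Pow)
  then show ?thesis unfolding lepoll_def by blast
qed

lemma lepoll_linear: "A \<lesssim> B \<or> B \<lesssim> A"
  using ordLeq_total[OF card_of_Well_order card_of_Well_order]
  by (metis card_of_ordLeq lepoll_def)

text \<open>A map that factors through another one has no more values.\<close>

lemma image_lepoll_image:
  assumes "\<And>x y. x \<in> A \<Longrightarrow> y \<in> A \<Longrightarrow> k x = k y \<Longrightarrow> h x = h y"
  shows "h ` A \<lesssim> k ` A"
proof -
  have "h x \<in> (\<lambda>z. h (inv_into A k z)) ` (k ` A)" if "x \<in> A" for x
  proof
    have "inv_into A k (k x) \<in> A" "k (inv_into A k (k x)) = k x"
      using that by (auto intro: inv_into_into f_inv_into_f)
    then show "h x = h (inv_into A k (k x))"
      using assms that by metis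
  qed (use that in auto)
  then show ?thesis
    by (intro subset_image_lepoll) auto
qed

section \<open>Successor cardinals\<close>

lemma lepoll_if_less_csucc:
  fixes \<alpha> \<kappa> :: "'o::ordinals"
  assumes "\<alpha> < csucc \<kappa>"
  shows "{..<\<alpha>} \<lesssim> {..<\<kappa>}"
proof -
  have "\<not> {..<\<kappa>} \<prec> {..<\<alpha>}"
    using assms not_less_Least unfolding csucc_def by blast
  then show ?thesis
    using lepoll_linear lepoll_iff_leqpoll eqpoll_imp_lepoll eqpoll_sym by metis
qed

lemma less_csucc_if_lepoll:
  fixes \<alpha> \<kappa> :: "'o::ordinals"
  assumes "{..<\<alpha>} \<lesssim> {..<\<kappa>}"
  shows "\<alpha> < csucc \<kappa>"
proof (rule ccontr)
  assume "\<not> \<alpha> < csucc \<kappa>"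
  then have "{..<csucc \<kappa>} \<lesssim> {..<\<alpha>}" by (intro lessThan_lepoll_mono) auto
  then show False
    using assms lesspoll_csucc[of \<kappa>] lesspoll_trans1 lepoll_trans lesspoll_not_refl by blast
qed

lemma atMost_lepoll:
  fixes \<alpha> :: "'o::ordinals"
  assumes "infinite K" "{..<\<alpha>} \<lesssim> K"
  shows "{..\<alpha>} \<lesssim> K"
  using insert_lepoll[OF assms, of \<alpha>] by (simp add: ivl_disj_un_singleton(2)[symmetric])

lemma csucc_regular:
  fixes \<kappa> :: "'o::ordinals"
  assumes "infinite {..<\<kappa>}" "A \<subseteq> {..<csucc \<kappa>}" "A \<lesssim> {..<\<kappa>}"
  shows "\<exists>\<beta><csucc \<kappa>. \<forall>\<alpha>\<in>A. \<alpha> < \<beta>"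
proof (rule ccontr)
  assume "\<not> ?thesis"
  then have "{..<csucc \<kappa>} \<subseteq> (\<Union>\<alpha>\<in>A. {..\<alpha>})"
    by (force simp: not_less)
  moreover have "(\<Union>\<alpha>\<in>A. {..\<alpha>}) \<lesssim> {..<\<kappa>}"
    using assms by (intro UN_lepoll atMost_lepoll lepoll_if_less_csucc) auto
  ultimately show False
    using lesspoll_csucc[of \<kappa>] subset_imp_lepoll lepoll_trans lesspoll_trans1
      lesspoll_not_refl by metis
qed

lemma csucc_pigeonhole:
  fixes \<kappa> :: "'o::ordinals" and h :: "'o \<Rightarrow> 'b"
  assumes "infinite {..<\<kappa>}" "h ` {..<csucc \<kappa>} \<lesssim> {..<\<kappa>}"
  shows "\<exists>\<alpha><csucc \<kappa>. \<forall>\<beta><csucc \<kappa>. \<exists>\<gamma>\<ge>\<beta>. \<gamma> < csucc \<kappa> \<and> h \<gamma> = h \<alpha>"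
proof (rule ccontr)
  assume "\<not> ?thesis"
  then have "\<forall>\<alpha><csucc \<kappa>. \<exists>\<beta><csucc \<kappa>. \<forall>\<gamma>\<ge>\<beta>. \<gamma> < csucc \<kappa> \<longrightarrow> h \<gamma> \<noteq> h \<alpha>"
    by blast
  then have "\<forall>y\<in>h ` {..<csucc \<kappa>}. \<exists>\<beta><csucc \<kappa>. \<forall>\<gamma>\<ge>\<beta>. \<gamma> < csucc \<kappa> \<longrightarrow> h \<gamma> \<noteq> y"
    by auto
  then obtain b where b: "\<And>y. y \<in> h ` {..<csucc \<kappa>} \<Longrightarrow> b y < csucc \<kappa>"
    "\<And>y \<gamma>. y \<in> h ` {..<csucc \<kappa>} \<Longrightarrow> b y \<le> \<gamma> \<Longrightarrow> \<gamma> < csucc \<kappa> \<Longrightarrow> h \<gamma> \<noteq> y"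
    by metis
  have "b ` h ` {..<csucc \<kappa>} \<subseteq> {..<csucc \<kappa>}" using b(1) by auto
  moreover have "b ` h ` {..<csucc \<kappa>} \<lesssim> {..<\<kappa>}"
    using assms(2) image_lepoll lepoll_trans by metis
  ultimately obtain \<beta> where "\<beta> < csucc \<kappa>" "\<forall>\<alpha>\<in>b ` h ` {..<csucc \<kappa>}. \<alpha> < \<beta>"
    using csucc_regular assms(1) by metis
  then show False
    using b(2)[of "h \<beta>" \<beta>] by (auto simp: less_imp_le)
qed

text \<open>
  Above every ordinal below \<open>\<chi>\<^sup>+\<^sup>+\<close> there is a block of order type \<open>\<chi>\<^sup>+\<close>; what matters is that
  no \<open>\<chi>\<close> of its elements are cofinal in it.
\<close>

lemma ex_block:
  fixes \<chi> :: "'o::ordinals"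
  defines "\<kappa> \<equiv> csucc \<chi>"
  assumes "infinite {..<\<chi>}" "\<beta> < csucc \<kappa>"
  shows "\<exists>b<csucc \<kappa>. \<forall>Y\<subseteq>{\<beta>..<b}. Y \<lesssim> {..<\<chi>} \<longrightarrow> (\<exists>x\<in>{\<beta>..<b}. \<forall>y\<in>Y. y < x)"
proof -
  have inf: "infinite {..<\<kappa>}"
    using assms(2) lesspoll_csucc[of \<chi>] unfolding \<kappa>_def
    by (metis infinite_le_lepoll lesspoll_imp_lepoll lepoll_trans)
  have "\<exists>b<csucc \<kappa>. \<not> {\<beta>..<b} \<lesssim> {..<\<chi>}"
  proof -
    have "\<not> {\<beta>..<csucc \<kappa>} \<lesssim> {..<\<kappa>}"
    proof
      assume "{\<beta>..<csucc \<kappa>} \<lesssim> {..<\<kappa>}"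
      moreover have "{..<csucc \<kappa>} = {..<\<beta>} \<union> {\<beta>..<csucc \<kappa>}"
        using assms(3) by auto
      ultimately have "{..<csucc \<kappa>} \<lesssim> {..<\<kappa>}"
        using inf assms(3) lepoll_if_less_csucc by (metis Un_lepoll)
      then show False
        using lesspoll_csucc[of \<kappa>] lesspoll_trans1 lesspoll_not_refl by blast
    qed
    then have "{..<\<kappa>} \<lesssim> {\<beta>..<csucc \<kappa>}" using lepoll_linear by blast
    then obtain f where f: "inj_on f {..<\<kappa>}" "f ` {..<\<kappa>} \<subseteq> {\<beta>..<csucc \<kappa>}"
      unfolding lepoll_def by blast
    obtain b where b: "b < csucc \<kappa>" "\<forall>\<alpha>\<in>f ` {..<\<kappa>}. \<alpha> < b"
      using csucc_regular[OF inf, of "f ` {..<\<kappa>}"] f(2) image_lepoll by fastforce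
    have "{..<\<kappa>} \<lesssim> {\<beta>..<b}"
      unfolding lepoll_def using f b by (intro exI[of _ f]) auto
    then have "\<not> {\<beta>..<b} \<lesssim> {..<\<chi>}"
      using lesspoll_csucc[of \<chi>] lesspoll_trans1 lepoll_trans lesspoll_not_refl
      unfolding \<kappa>_def by blast
    with b(1) show ?thesis by blast
  qed
  then obtain b0 where b0: "b0 < csucc \<kappa>" "\<not> {\<beta>..<b0} \<lesssim> {..<\<chi>}" by blast
  define b where "b = (LEAST b. \<not> {\<beta>..<b} \<lesssim> {..<\<chi>})"
  have b: "\<not> {\<beta>..<b} \<lesssim> {..<\<chi>}" "b \<le> b0"
    unfolding b_def by (rule LeastI, rule b0(2)) (rule Least_le, rule b0(2))
  have below: "{\<beta>..<x} \<lesssim> {..<\<chi>}" if "x < b" for x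
    using not_less_Least that unfolding b_def by blast
  have "\<exists>x\<in>{\<beta>..<b}. \<forall>y\<in>Y. y < x" if Y: "Y \<subseteq> {\<beta>..<b}" "Y \<lesssim> {..<\<chi>}" for Y
  proof (rule ccontr)
    assume "\<not> ?thesis"
    then have "\<exists>y\<in>Y. x \<le> y" if "x \<in> {\<beta>..<b}" for x
      using that by (meson not_le)
    then have "{\<beta>..<b} \<subseteq> (\<Union>y\<in>Y. insert y {\<beta>..<y})"
      by (fastforce simp: order_le_less)
    moreover have "(\<Union>y\<in>Y. insert y {\<beta>..<y}) \<lesssim> {..<\<chi>}"
      using assms(2) Y below by (intro UN_lepoll insert_lepoll) auto
    ultimately show False
      using b(1) subset_imp_lepoll lepoll_trans by blast
  qed
  then show ?thesis
    using b(2) b0(1) by (intro exI[of _ b]) auto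
qed


section \<open>The beth function\<close>

lemma less_cpow2: "\<kappa> < cpow2 \<kappa>"
  by (rule less_if_Pow_lepoll) (rule eqpoll_imp_lepoll, rule eqpoll_cpow2)

lemma cpow2_mono: "\<alpha> \<le> \<beta> \<Longrightarrow> cpow2 \<alpha> \<le> cpow2 \<beta>"
  by (meson Pow_lepoll_mono cpow2_le eqpoll_cpow2 lepoll_trans2 lessThan_lepoll_mono)

lemma csucc_le_cpow2: "csucc \<kappa> \<le> cpow2 \<kappa>"
proof -
  have "{..<\<kappa>} \<prec> {..<cpow2 \<kappa>}"
    using lesspoll_Pow_self eqpoll_cpow2 lesspoll_eq_trans by blast
  then show ?thesis unfolding csucc_def by (rule Least_le)
qed

lemma osup_upper: "\<forall>\<alpha>\<in>A. \<alpha> \<le> \<delta> \<Longrightarrow> \<alpha> \<in> A \<Longrightarrow> \<alpha> \<le> osup A"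
  unfolding osup_def using LeastI[of "\<lambda>\<beta>. \<forall>\<alpha>\<in>A. \<alpha> \<le> \<beta>" \<delta>] by blast

lemma beth_less_imp_le: "\<gamma> < \<alpha> \<Longrightarrow> beth \<gamma> \<kappa> \<le> beth \<alpha> \<kappa>"
proof (induction \<alpha> arbitrary: \<gamma> rule: less_induct)
  case (less \<alpha>)
  show ?case
  proof (cases "\<exists>\<beta>. \<alpha> = osuc \<beta>")
    case True
    then obtain \<beta> where \<beta>: "\<alpha> = osuc \<beta>" by blast
    have "\<not> \<beta> < \<gamma>"
      using less.prems osuc_le_iff[of \<beta> \<gamma>] leD unfolding \<beta> by blast
    then have "\<gamma> \<le> \<beta>" by simp
    moreover have "\<beta> < \<alpha>" unfolding \<beta> by (rule less_osuc)
    ultimately have "beth \<gamma> \<kappa> \<le> beth \<beta> \<kappa>"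
      using less.IH[of \<beta> \<gamma>] by (auto simp: order_le_less)
    also have "\<dots> \<le> beth \<alpha> \<kappa>"
      unfolding \<beta> beth_osuc by (intro less_imp_le less_cpow2)
    finally show ?thesis .
  next
    case False
    obtain \<delta> where "\<forall>\<beta>\<le>\<alpha>. beth \<beta> \<kappa> \<le> \<delta>" using bdd_above_beth by blast
    then have "\<forall>\<beta>\<in>(\<lambda>\<beta>. beth \<beta> \<kappa>) ` {..<\<alpha>}. \<beta> \<le> \<delta>" by auto
    from osup_upper[OF this] have "beth \<gamma> \<kappa> \<le> osup ((\<lambda>\<beta>. beth \<beta> \<kappa>) ` {..<\<alpha>})"
      using less.prems by blast
    then show ?thesis
      using beth_limit[OF less.prems] False by metis
  qed
qed

lemma beth_mono: "\<alpha> \<le> \<beta> \<Longrightarrow> beth \<alpha> \<kappa> \<le> beth \<beta> \<kappa>"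
  using beth_less_imp_le[of \<alpha> \<beta> \<kappa>] by (auto simp: order_le_less)

lemma infinite_lessThan_aleph0: "infinite {..<aleph0::'o::ordinals}"
proof -
  obtain \<alpha> :: 'o where "(UNIV::nat set) \<lesssim> {..<\<alpha>}"
    using ex_infinite infinite_le_lepoll by blast
  then show ?thesis
    unfolding aleph0_def using eqpoll_ocard(1) eqpoll_finite_iff by fastforce
qed

lemma lessThan_osuc: "{..<osuc \<alpha>} = insert \<alpha> {..<\<alpha>}"
proof -
  have "x < osuc \<alpha> \<longleftrightarrow> x \<le> \<alpha>" for x
    using osuc_le_iff[of \<alpha> x] not_le[of "osuc \<alpha>" x] not_less[of \<alpha> x] by argo
  then show ?thesis
    by (intro set_eqI) (simp add: order_le_less disj_commute)
qed

text \<open>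
  The cardinal \<open>\<beth>\<^sub>\<omega>(\<psi>)\<close> and its finitely iterated powers lie below \<open>\<beth>\<^bsub>\<theta>\<^sup>+\<^esub>(\<psi>)\<close>, because \<open>\<theta>\<^sup>+\<close> is a limit ordinal above \<open>\<omega>\<close>.
\<close>

lemma ex_power_sequence:
  fixes \<theta> \<psi> :: "'o::ordinals"
  assumes "infinite {..<\<theta>}"
  shows "\<exists>a \<chi>. a 0 = \<psi> \<and> (\<forall>k::nat. a (Suc k) = cpow2 (a k)) \<and> (\<forall>k. a k \<le> \<chi>) \<and>
    (\<forall>j. (cpow2 ^^ j) \<chi> < beth (csucc \<theta>) \<psi>)"
proof -
  define z where "z = (LEAST \<alpha>::'o. True)"
  have z: "z \<le> \<beta>" for \<beta> unfolding z_def by (rule Least_le) simp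
  define a where "a k = beth ((osuc ^^ k) z) \<psi>" for k
  define \<chi> where "\<chi> = beth aleph0 \<psi>"
  have "finite {..<(osuc ^^ k) z}" for k
  proof (induction k)
    case 0
    have "{..<z} = {}" using z by (auto simp flip: not_le)
    then show ?case by simp
  qed (simp add: lessThan_osuc)
  then have "(osuc ^^ k) z \<le> aleph0" for k
    using infinite_lessThan_aleph0 by (meson finite_subset lessThan_subset_iff linear)
  then have "a k \<le> \<chi>" for k
    unfolding a_def \<chi>_def by (rule beth_mono)
  moreover have "a 0 = \<psi>" "a (Suc k) = cpow2 (a k)" for k
    unfolding a_def by (auto simp: beth_osuc intro!: beth_zero z)
  moreover have "(cpow2 ^^ j) \<chi> < beth (csucc \<theta>) \<psi>" for j
  proof -
    have "{..<(osuc ^^ j) (aleph0::'o)} \<lesssim> {..<\<theta>}"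
    proof (induction j)
      case 0
      have "(UNIV::nat set) \<lesssim> {..<\<theta>}" using assms infinite_le_lepoll by blast
      then show ?case
        unfolding aleph0_def using eqpoll_ocard(1) eqpoll_sym lepoll_trans1 by fastforce
    next
      case (Suc j)
      then show ?case using assms by (simp add: lessThan_osuc insert_lepoll)
    qed
    then have "osuc ((osuc ^^ j) aleph0) \<le> csucc \<theta>"
      using less_csucc_if_lepoll osuc_le_iff by blast
    then have "beth (osuc ((osuc ^^ j) aleph0)) \<psi> \<le> beth (csucc \<theta>) \<psi>"
      by (rule beth_mono)
    moreover have "beth ((osuc ^^ j) aleph0) \<psi> = (cpow2 ^^ j) \<chi>"
      by (induction j) (auto simp: \<chi>_def beth_osuc)
    ultimately show ?thesis
      using less_cpow2 by (metis beth_osuc order_less_le_trans)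
  qed
  ultimately show ?thesis by (intro exI[of _ a] exI[of _ \<chi>]) blast
qed


lemma eqpoll_cadd:
  fixes \<kappa> \<mu> :: "'o::ordinals"
  shows "{..<cadd \<kappa> \<mu>} \<approx> {..<\<kappa>} <+> {..<\<mu>}"
proof -
  define \<nu> where "\<nu> = max aleph0 (max \<kappa> \<mu>)"
  have inf: "infinite {..<\<nu>}"
    using infinite_lessThan_aleph0 lessThan_lepoll_mono[of aleph0 \<nu>] lepoll_trans
    unfolding infinite_le_lepoll \<nu>_def by fastforce
  have "{..<\<kappa>} <+> {..<\<mu>} \<lesssim> {..<\<nu>}"
    unfolding Plus_def
    by (intro Un_lepoll[OF inf] lepoll_trans[OF image_lepoll] lessThan_lepoll_mono)
      (simp_all add: \<nu>_def le_max_iff_disj)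
  then show ?thesis
    unfolding cadd_def using eqpoll_ocard(1) eqpoll_sym by blast
qed

lemma lepoll_cadd: "{..<\<kappa>} \<lesssim> {..<cadd \<kappa> \<mu>}" "{..<\<mu>} \<lesssim> {..<cadd \<kappa> \<mu>}"
proof -
  have "{..<\<kappa>} \<lesssim> {..<\<kappa>} <+> {..<\<mu>}" "{..<\<mu>} \<lesssim> {..<\<kappa>} <+> {..<\<mu>}"
    unfolding Plus_def lepoll_def by (intro exI[of _ Inl], simp) (intro exI[of _ Inr], simp)
  then show "{..<\<kappa>} \<lesssim> {..<cadd \<kappa> \<mu>}" "{..<\<mu>} \<lesssim> {..<cadd \<kappa> \<mu>}"
    using eqpoll_cadd eqpoll_sym lepoll_trans2 by blast+
qed

text \<open>A function into a power set is determined by its graph, a subset of a product.\<close>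

lemma functions_lepoll_cpow2:
  fixes \<kappa> :: "'o::ordinals"
  assumes "infinite {..<\<kappa>}"
  shows "{\<phi> :: nat \<times> nat \<Rightarrow> 'o. \<forall>p. \<phi> p < cpow2 \<kappa>} \<lesssim> {..<cpow2 \<kappa>}"
proof -
  obtain e where e: "inj_on e {..<cpow2 \<kappa>}" "e ` {..<cpow2 \<kappa>} \<subseteq> Pow {..<\<kappa>}"
    using eqpoll_imp_lepoll[OF eqpoll_sym[OF eqpoll_cpow2]] unfolding lepoll_def by blast
  define graph where "graph \<phi> = {(p, z). z \<in> e (\<phi> p)}" for \<phi> :: "nat \<times> nat \<Rightarrow> 'o"
  have inj: "\<phi> = \<phi>'" if "\<forall>p. \<phi> p < cpow2 \<kappa>" "\<forall>p. \<phi>' p < cpow2 \<kappa>" "graph \<phi> = graph \<phi>'" for \<phi> \<phi>'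
  proof
    fix p
    have "z \<in> e (\<phi> p) \<longleftrightarrow> z \<in> e (\<phi>' p)" for z
    proof -
      have "(p, z) \<in> graph \<phi> \<longleftrightarrow> (p, z) \<in> graph \<phi>'" using that(3) by simp
      then show ?thesis by (simp add: graph_def)
    qed
    then have "e (\<phi> p) = e (\<phi>' p)" by blast
    then show "\<phi> p = \<phi>' p"
      by (rule inj_onD[OF e(1)]) (use that(1,2) in \<open>simp_all only: lessThan_iff\<close>)
  qed
  have "{\<phi> :: nat \<times> nat \<Rightarrow> 'o. \<forall>p. \<phi> p < cpow2 \<kappa>} \<lesssim> Pow ((UNIV :: (nat \<times> nat) set) \<times> {..<\<kappa>})"
    unfolding lepoll_def
  proof (intro exI[of _ graph] conjI inj_onI image_subsetI PowI)
    show "graph \<phi> \<subseteq> UNIV \<times> {..<\<kappa>}" if "\<phi> \<in> {\<phi>. \<forall>p. \<phi> p < cpow2 \<kappa>}" for \<phi> :: "nat \<times> nat \<Rightarrow> 'o"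
      using e(2) that by (fastforce simp: graph_def)
  qed (rule inj, simp_all)
  also have "(UNIV :: (nat \<times> nat) set) \<lesssim> {..<\<kappa>}"
  proof -
    have "(UNIV :: nat set) \<lesssim> {..<\<kappa>}" using assms infinite_le_lepoll by blast
    then show ?thesis
      unfolding UNIV_Times_UNIV[symmetric] by (intro Times_lepoll assms)
  qed
  then have "Pow ((UNIV :: (nat \<times> nat) set) \<times> {..<\<kappa>}) \<lesssim> Pow {..<\<kappa>}"
    by (intro Pow_lepoll_mono Times_lepoll assms) auto
  also have "\<dots> \<lesssim> {..<cpow2 \<kappa>}" by (rule eqpoll_imp_lepoll[OF eqpoll_cpow2])
  finally show ?thesis .
qed

lemma le_beth: "\<kappa> \<le> beth \<alpha> \<kappa>" for \<kappa> :: "'o::ordinals"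
proof -
  have z: "(LEAST \<alpha>::'o. True) \<le> \<beta>" for \<beta> by (rule Least_le) simp
  show ?thesis using beth_mono[OF z, of \<kappa> \<alpha>] beth_zero[OF z] by simp
qed

lemma infinite_lessThan_beth1:
  assumes "infinite {..<\<theta>::'o::ordinals}"
  shows "infinite {..<beth1 n \<theta> \<mu>}"
proof (induction n)
  case (Suc n)
  let ?\<psi> = "cadd (beth1 n \<theta> \<mu>) \<mu>"
  have "{..<beth1 n \<theta> \<mu>} \<lesssim> {..<?\<psi>}" by (rule lepoll_cadd)
  also have "\<dots> \<lesssim> {..<beth1 (Suc n) \<theta> \<mu>}" by (simp add: lessThan_lepoll_mono le_beth)
  finally show ?case using Suc.IH lepoll_trans unfolding infinite_le_lepoll by blast
qed (use assms in simp)


section \<open>The order \<open>lx2\<close>\<close>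

abbreviation lcp_length :: "'a list \<Rightarrow> 'a list \<Rightarrow> nat" where
  "lcp_length \<eta> \<nu> \<equiv> length (longest_common_prefix \<eta> \<nu>)"

lemma lx2_Nil_left [simp]: "\<not> lx2 [] \<nu>"
  by (auto simp: lx2_def lx_split_def)

lemma lx2_Nil_right [simp]: "lx2 \<eta> [] \<longleftrightarrow> \<eta> \<noteq> []"
  by (cases \<eta>) (auto simp: lx2_def lx_split_def)

text \<open>This recursion reduces all order properties of \<open>lx2\<close> to inductions on lists.\<close>

lemma lx2_Cons [simp]: "lx2 (\<alpha> # \<eta>) (\<beta> # \<nu>) \<longleftrightarrow> \<alpha> < \<beta> \<or> \<alpha> = \<beta> \<and> lx2 \<eta> \<nu>"
proof -
  have "lx_split (\<alpha> # \<eta>) (\<beta> # \<nu>) \<longleftrightarrow> \<alpha> < \<beta> \<or> \<alpha> = \<beta> \<and> lx_split \<eta> \<nu>"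
  proof
    assume "lx_split (\<alpha> # \<eta>) (\<beta> # \<nu>)"
    then obtain l where "l < min (Suc (length \<eta>)) (Suc (length \<nu>))"
      "take l (\<alpha> # \<eta>) = take l (\<beta> # \<nu>)" "(\<alpha> # \<eta>) ! l < (\<beta> # \<nu>) ! l"
      by (auto simp: lx_split_def)
    then show "\<alpha> < \<beta> \<or> \<alpha> = \<beta> \<and> lx_split \<eta> \<nu>"
      by (cases l) (auto simp: lx_split_def)
  next
    assume "\<alpha> < \<beta> \<or> \<alpha> = \<beta> \<and> lx_split \<eta> \<nu>"
    then show "lx_split (\<alpha> # \<eta>) (\<beta> # \<nu>)"
    proof
      assume "\<alpha> < \<beta>"
      then show ?thesis unfolding lx_split_def by (intro exI[of _ 0]) auto
    next
      assume "\<alpha> = \<beta> \<and> lx_split \<eta> \<nu>"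
      then obtain l where "l < min (length \<eta>) (length \<nu>)"
        "take l \<eta> = take l \<nu>" "\<eta> ! l < \<nu> ! l" "\<alpha> = \<beta>"
        by (auto simp: lx_split_def)
      then show ?thesis unfolding lx_split_def by (intro exI[of _ "Suc l"]) auto
    qed
  qed
  then show ?thesis by (auto simp: lx2_def)
qed

lemma lx2_irrefl [simp]: "\<not> lx2 \<eta> \<eta>"
  by (induction \<eta>) auto

lemma lx2_trans: "lx2 \<eta> \<nu> \<Longrightarrow> lx2 \<nu> \<rho> \<Longrightarrow> lx2 \<eta> \<rho>"
proof (induction \<nu> arbitrary: \<eta> \<rho>)
  case step: (Cons \<alpha> \<nu>)
  show ?case
  proof (cases \<eta>)
    case (Cons \<beta> \<eta>')
    then have "\<beta> < \<alpha> \<or> \<beta> = \<alpha> \<and> lx2 \<eta>' \<nu>" using step.prems(1) by simp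
    then show ?thesis
    proof (cases \<rho>)
      case (Cons \<gamma> \<rho>')
      then have "\<alpha> < \<gamma> \<or> \<alpha> = \<gamma> \<and> lx2 \<nu> \<rho>'" using step.prems(2) by simp
      with \<open>\<beta> < \<alpha> \<or> \<beta> = \<alpha> \<and> lx2 \<eta>' \<nu>\<close> show ?thesis
        using step.IH order_less_trans unfolding Cons \<open>\<eta> = \<beta> # \<eta>'\<close> lx2_Cons by blast
    qed (simp add: \<open>\<eta> = \<beta> # \<eta>'\<close>)
  qed (use step.prems(1) in simp)
qed simp

lemma lx2_total: "\<eta> \<noteq> \<nu> \<Longrightarrow> lx2 \<eta> \<nu> \<or> lx2 \<nu> \<eta>"
proof (induction \<eta> arbitrary: \<nu>)
  case Nil
  then show ?case by (cases \<nu>) auto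
next
  case (Cons \<alpha> \<eta>)
  then show ?case by (cases \<nu>) auto
qed

lemma lx2_append [simp]: "lx2 (\<sigma> @ \<eta>) (\<sigma> @ \<nu>) \<longleftrightarrow> lx2 \<eta> \<nu>"
  by (induction \<sigma>) auto

lemma lcp_length_append [simp]: "lcp_length (\<sigma> @ \<eta>) (\<sigma> @ \<nu>) = length \<sigma> + lcp_length \<eta> \<nu>"
  by (induction \<sigma>) auto

lemma lcp_length_append_self [simp]:
  "lcp_length (\<sigma> @ \<eta>) \<sigma> = length \<sigma>" "lcp_length \<sigma> (\<sigma> @ \<nu>) = length \<sigma>"
  by (induction \<sigma>) (auto simp: neq_Nil_conv elim: longest_common_prefix.elims)

lemma lcp_length_self [simp]: "lcp_length \<sigma> \<sigma> = length \<sigma>"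
  by (induction \<sigma>) auto

lemma lx2_append_self [simp]: "lx2 (\<sigma> @ \<eta>) \<sigma> \<longleftrightarrow> \<eta> \<noteq> []" "\<not> lx2 \<sigma> (\<sigma> @ \<nu>)"
  by (induction \<sigma>) auto

lemma prefix_iff_lcp_length: "prefix \<eta> \<nu> \<longleftrightarrow> lcp_length \<eta> \<nu> = length \<eta>"
proof
  assume "lcp_length \<eta> \<nu> = length \<eta>"
  then have "longest_common_prefix \<eta> \<nu> = \<eta>"
    using longest_common_prefix_prefix1[of \<eta> \<nu>]
    by (metis append_eq_append_conv append_Nil2 prefixE)
  then show "prefix \<eta> \<nu>"
    using longest_common_prefix_prefix2[of \<eta> \<nu>] by simp
qed (auto simp: prefix_def)

lemma lx1_iff: "lx1 \<eta> \<nu> \<longleftrightarrow> strict_prefix \<eta> \<nu> \<or> lx2 \<eta> \<nu> \<and> \<not> strict_prefix \<nu> \<eta>"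
proof -
  have "\<not> strict_prefix \<nu> \<eta>" if "lx_split \<eta> \<nu>"
    using that by (auto simp: lx_split_def strict_prefix_def prefix_def nth_append)
  then show ?thesis by (auto simp: lx1_def lx2_def)
qed

lemma ex_lx2_max:
  assumes "finite u" "u \<noteq> {}"
  shows "\<exists>\<eta>\<in>u. \<forall>\<nu>\<in>u. \<nu> = \<eta> \<or> lx2 \<nu> \<eta>"
  using assms
proof (induction u rule: finite_ne_induct)
  case (insert \<rho> u)
  then obtain \<eta> where \<eta>: "\<eta> \<in> u" "\<forall>\<nu>\<in>u. \<nu> = \<eta> \<or> lx2 \<nu> \<eta>" by blast
  show ?case
  proof (cases "\<rho> = \<eta> \<or> lx2 \<rho> \<eta>")
    case True
    then show ?thesis using \<eta> by (intro bexI[of _ \<eta>]) auto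
  next
    case False
    then have "lx2 \<eta> \<rho>" using lx2_total by blast
    then have "lx2 \<nu> \<rho>" if "\<nu> \<in> u" for \<nu>
      using \<eta>(2) that lx2_trans by metis
    then show ?thesis by (intro bexI[of _ \<rho>]) auto
  qed
qed auto

lemma ex_lx2_sorted:
  assumes "finite u"
  shows "\<exists>\<eta>s. sorted_wrt lx2 \<eta>s \<and> set \<eta>s = u"
  using assms
proof (induction "card u" arbitrary: u)
  case 0
  then show ?case by (intro exI[of _ "[]"]) auto
next
  case (Suc n)
  then have "u \<noteq> {}" by auto
  then obtain \<eta> where \<eta>: "\<eta> \<in> u" "\<forall>\<nu>\<in>u. \<nu> = \<eta> \<or> lx2 \<nu> \<eta>"
    using ex_lx2_max[OF Suc.prems] by blast
  have "n = card (u - {\<eta>})" using Suc.hyps(2) \<eta>(1) Suc.prems by simp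
  from Suc.hyps(1)[OF this] obtain \<eta>s where "sorted_wrt lx2 \<eta>s" "set \<eta>s = u - {\<eta>}"
    using Suc.prems by blast
  then show ?case
    using \<eta> by (intro exI[of _ "\<eta>s @ [\<eta>]"]) (auto simp: sorted_wrt_append)
qed

lemma lx2_sorted_unique:
  assumes "sorted_wrt lx2 \<eta>s" "sorted_wrt lx2 \<nu>s" "set \<eta>s = set \<nu>s"
  shows "\<eta>s = \<nu>s"
  using assms
proof (induction \<eta>s arbitrary: \<nu>s)
  case (Cons \<eta> \<eta>s)
  then obtain \<nu> \<nu>s' where \<nu>: "\<nu>s = \<nu> # \<nu>s'" by (cases \<nu>s) auto
  have "\<eta> = \<nu>"
  proof (rule ccontr)
    assume "\<eta> \<noteq> \<nu>"
    then have "\<eta> \<in> set \<nu>s'" "\<nu> \<in> set \<eta>s" using Cons.prems(3) \<nu> by auto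
    then have "lx2 \<nu> \<eta>" "lx2 \<eta> \<nu>" using Cons.prems(1,2) \<nu> by auto
    then show False using lx2_trans[of \<nu> \<eta> \<nu>] by simp
  qed
  moreover have "\<eta> \<notin> set \<eta>s" "\<nu> \<notin> set \<nu>s'" using Cons.prems(1,2) \<nu> by auto
  ultimately have "set \<eta>s = set \<nu>s'" using Cons.prems(3) \<nu> by auto
  then show ?case using Cons.IH[of \<nu>s'] Cons.prems(1,2) \<nu> \<open>\<eta> = \<nu>\<close> by simp
qed auto

lemma lx2_list:
  assumes "finite u"
  shows "sorted_wrt lx2 (lx2_list u)" "set (lx2_list u) = u"
proof -
  have "\<exists>!\<eta>s. sorted_wrt lx2 \<eta>s \<and> set \<eta>s = u"
    using ex_lx2_sorted[OF assms] lx2_sorted_unique by blast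
  from theI'[OF this] show "sorted_wrt lx2 (lx2_list u)" "set (lx2_list u) = u"
    unfolding lx2_list_def by auto
qed

lemma distinct_if_lx2_sorted: "sorted_wrt lx2 \<eta>s \<Longrightarrow> distinct \<eta>s"
  by (induction \<eta>s) auto


section \<open>Trees of all decreasing sequences below a bound\<close>

definition ds_below :: "'o::ordinals \<Rightarrow> 'o list set" where
  "ds_below \<Theta> = {\<eta> \<in> ds. set \<eta> \<subseteq> {..<\<Theta>}}"

lemma ds_append_singleton: "\<eta> @ [\<alpha>] \<in> ds \<longleftrightarrow> \<eta> \<in> ds \<and> (\<eta> \<noteq> [] \<longrightarrow> \<alpha> < last \<eta>)"
proof (cases \<eta> rule: rev_cases)
  case (snoc \<nu> \<beta>)
  then show ?thesis by (auto simp: ds_def sorted_wrt_append intro: order_less_trans)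
qed (simp add: ds_def)

text \<open>A decreasing sequence is determined by its set of entries.\<close>

lemma ds_below_lepoll: "ds_below \<Theta> \<lesssim> Pow {..<\<Theta>}"
proof -
  have "\<eta> = \<nu>" if "\<eta> \<in> ds" "\<nu> \<in> ds" "set \<eta> = set \<nu>" for \<eta> \<nu> :: "'a list"
  proof -
    have "sorted_wrt (<) (rev \<eta>)" "sorted_wrt (<) (rev \<nu>)"
      using that(1,2) by (auto simp: ds_def sorted_wrt_rev)
    then have "rev \<eta> = rev \<nu>"
      using that(3) by (intro strict_sorted_equal) auto
    then show ?thesis by simp
  qed
  then have "inj_on set (ds_below \<Theta>)" by (auto simp: inj_on_def ds_below_def)
  then show ?thesis
    unfolding lepoll_def by (intro exI[of _ set]) (auto simp: ds_below_def)
qed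

lemma tree_ds_below: "tree (ds_below \<Theta>)"
proof -
  have small: "small TYPE('a) (ds_below \<Theta>)"
    using ds_below_lepoll eqpoll_cpow2 lepoll_trans2 unfolding small_def by blast
  have "[] \<in> ds_below \<Theta>" by (simp add: ds_below_def ds_def)
  then have "ds_below \<Theta> \<noteq> {}" by blast
  moreover have "\<nu> \<in> ds_below \<Theta>" if "\<eta> \<in> ds_below \<Theta>" "prefix \<nu> \<eta>" for \<eta> \<nu>
    using that by (auto simp: ds_below_def ds_def prefix_def sorted_wrt_append)
  moreover have "ds_below \<Theta> \<subseteq> ds" by (auto simp: ds_below_def)
  ultimately show ?thesis using small unfolding tree_def by blast
qed

text \<open>
  Induction from the children to the parent. It is justified by the last entry, which decreases
  from a non-empty sequence to its children; the empty sequence comes at the end.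
\<close>

lemma ds_children_induct:
  assumes "\<sigma> \<in> S" "S \<subseteq> ds"
    and step: "\<And>\<sigma>. \<sigma> \<in> S \<Longrightarrow> (\<And>\<alpha>. \<sigma> @ [\<alpha>] \<in> S \<Longrightarrow> P (\<sigma> @ [\<alpha>])) \<Longrightarrow> P \<sigma>"
  shows "P \<sigma>"
proof -
  have nonempty: "P (\<sigma> @ [\<alpha>])" if "\<sigma> @ [\<alpha>] \<in> S" for \<sigma> \<alpha>
    using that
  proof (induction \<alpha> arbitrary: \<sigma> rule: less_induct)
    case (less \<alpha>)
    show ?case
    proof (rule step[OF less.prems])
      fix \<beta> assume "(\<sigma> @ [\<alpha>]) @ [\<beta>] \<in> S"
      moreover from this have "\<beta> < \<alpha>"
        using assms(2) ds_append_singleton[of "\<sigma> @ [\<alpha>]" \<beta>] by auto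
      ultimately show "P ((\<sigma> @ [\<alpha>]) @ [\<beta>])" using less.IH by blast
    qed
  qed
  show ?thesis by (rule step[OF assms(1) nonempty])
qed


section \<open>Copies of a tree\<close>

text \<open>
  Preserving lengths, branching levels and \<open>lx2\<close> amounts to preserving similarity types. It
  implies the defining properties of a tree embedding, since initial segments are the sequences
  with maximal branching level.
\<close>

definition lx2_embedding :: "('o::ordinals list \<Rightarrow> 'o list) \<Rightarrow> 'o list set \<Rightarrow> bool" where
  "lx2_embedding f A \<longleftrightarrow> (\<forall>\<eta>\<in>A. \<forall>\<nu>\<in>A. length (f \<eta>) = length \<eta> \<and>
     lcp_length (f \<eta>) (f \<nu>) = lcp_length \<eta> \<nu> \<and> (lx2 \<eta> \<nu> \<longrightarrow> lx2 (f \<eta>) (f \<nu>)))"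

lemma lx2_embeddingD:
  assumes "lx2_embedding f A" "\<eta> \<in> A" "\<nu> \<in> A"
  shows "length (f \<eta>) = length \<eta>" "lcp_length (f \<eta>) (f \<nu>) = lcp_length \<eta> \<nu>"
    "lx2 (f \<eta>) (f \<nu>) \<longleftrightarrow> lx2 \<eta> \<nu>" "prefix (f \<eta>) (f \<nu>) \<longleftrightarrow> prefix \<eta> \<nu>"
    "f \<eta> = f \<nu> \<longleftrightarrow> \<eta> = \<nu>"
proof -
  show *: "length (f \<eta>) = length \<eta>" "lcp_length (f \<eta>) (f \<nu>) = lcp_length \<eta> \<nu>"
    using assms by (auto simp: lx2_embedding_def)
  then show "prefix (f \<eta>) (f \<nu>) \<longleftrightarrow> prefix \<eta> \<nu>" by (simp add: prefix_iff_lcp_length)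
  have imp: "lx2 (f x) (f y)" if "lx2 x y" "x \<in> A" "y \<in> A" for x y
    using assms that by (auto simp: lx2_embedding_def)
  show "lx2 (f \<eta>) (f \<nu>) \<longleftrightarrow> lx2 \<eta> \<nu>" "f \<eta> = f \<nu> \<longleftrightarrow> \<eta> = \<nu>"
    using imp assms lx2_total[of \<eta> \<nu>] lx2_trans lx2_irrefl by metis+
qed

lemma lx2_embedding_id: "lx2_embedding (\<lambda>\<eta>. \<eta>) A"
  by (simp add: lx2_embedding_def)

lemma lx2_embedding_comp:
  assumes "lx2_embedding f A" "lx2_embedding h C" "f ` A \<subseteq> C"
  shows "lx2_embedding (\<lambda>\<eta>. h (f \<eta>)) A"
  using assms lx2_embeddingD[OF assms(1)] lx2_embeddingD[OF assms(2)]
  by (auto simp: lx2_embedding_def image_subset_iff)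

lemma tree_isomorphic_image:
  assumes "lx2_embedding f S"
  shows "tree_isomorphic S (f ` S)"
proof -
  have "lx1 (f \<eta>) (f \<nu>)" if "lx1 \<eta> \<nu>" "\<eta> \<in> S" "\<nu> \<in> S" for \<eta> \<nu>
    using that lx2_embeddingD[OF assms] by (auto simp: lx1_iff strict_prefix_def)
  moreover have "strict_prefix (f \<eta>) (f \<nu>)" if "strict_prefix \<eta> \<nu>" "\<eta> \<in> S" "\<nu> \<in> S" for \<eta> \<nu>
    using that lx2_embeddingD[OF assms] by (auto simp: strict_prefix_def)
  ultimately show ?thesis
    unfolding tree_isomorphic_def tree_embedding_def
    using lx2_embeddingD(1)[OF assms] by (intro exI[of _ f]) auto
qed

text \<open>An initial segment of \<open>f \<eta>\<close> is the image of the initial segment of \<open>\<eta>\<close> of the same length.\<close>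

lemma subtree_image:
  assumes f: "lx2_embedding f S" "f ` S \<subseteq> T" and "tree S" "tree T"
  shows "subtree (f ` S) T"
proof -
  have "\<nu> \<in> f ` S" if "\<eta> \<in> S" "prefix \<nu> (f \<eta>)" for \<eta> \<nu>
  proof -
    define \<eta>' where "\<eta>' = take (length \<nu>) \<eta>"
    have "prefix \<eta>' \<eta>" by (simp add: \<eta>'_def take_is_prefix)
    then have \<eta>': "\<eta>' \<in> S" using \<open>tree S\<close> that(1) by (auto simp: tree_def)
    have "prefix (f \<eta>') (f \<eta>)"
      using \<open>prefix \<eta>' \<eta>\<close> lx2_embeddingD(4)[OF f(1) \<eta>' that(1)] by simp
    moreover have "length \<nu> \<le> length \<eta>"
      using prefix_length_le[OF that(2)] lx2_embeddingD(1)[OF f(1) that(1) that(1)] by simp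
    then have "length (f \<eta>') = length \<nu>"
      using lx2_embeddingD(1)[OF f(1) \<eta>' \<eta>'] by (simp add: \<eta>'_def)
    ultimately have "\<nu> = f \<eta>'"
      using that(2) by (auto simp: prefix_def append_eq_append_conv)
    then show ?thesis using \<eta>' by blast
  qed
  moreover have "small TYPE('a) (f ` S)"
    using \<open>tree S\<close> image_lepoll lepoll_trans unfolding tree_def small_def by blast
  ultimately show ?thesis
    using f(2) \<open>tree S\<close> \<open>tree T\<close> unfolding subtree_def tree_def by auto
qed

definition cone :: "'o list set \<Rightarrow> 'o list \<Rightarrow> 'o list set" where
  "cone S \<sigma> = {\<eta> \<in> S. prefix \<sigma> \<eta>}"

text \<open>
  Uniformity for one end element, in a relative version: \<open>b\<close> is a fixed set of nodes outside the
  copy, later the part of a finite set that lies in the copies of subtrees further to the left.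
\<close>

definition tail_uniform ::
    "('o::ordinals list set \<Rightarrow> 'c) \<Rightarrow> 'o list set \<Rightarrow> ('o list \<Rightarrow> 'o list) \<Rightarrow> 'o list set \<Rightarrow> bool"
  where
  "tail_uniform c b f A \<longleftrightarrow>
     (\<forall>u \<eta> \<rho> \<rho>'. finite u \<and> u \<subseteq> A \<and> \<eta> \<in> u \<and> (\<forall>\<nu>\<in>u. \<nu> = \<eta> \<or> lx2 \<nu> \<eta>) \<and>
        \<rho> \<in> A \<and> \<rho>' \<in> A \<and> lx2 \<eta> \<rho> \<and> lx2 \<eta> \<rho>' \<and>
        length \<rho> = length \<rho>' \<and> lcp_length \<eta> \<rho> = lcp_length \<eta> \<rho>' \<longrightarrow>
        c (insert (f \<rho>) (b \<union> f ` u)) = c (insert (f \<rho>') (b \<union> f ` u)))"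

lemma tail_uniformD:
  assumes "tail_uniform c b f A" "finite u" "u \<subseteq> A" "\<eta> \<in> u" "\<And>\<nu>. \<nu> \<in> u \<Longrightarrow> \<nu> = \<eta> \<or> lx2 \<nu> \<eta>"
    "\<rho> \<in> A" "\<rho>' \<in> A" "lx2 \<eta> \<rho>" "lx2 \<eta> \<rho>'" "length \<rho> = length \<rho>'"
    "lcp_length \<eta> \<rho> = lcp_length \<eta> \<rho>'"
  shows "c (insert (f \<rho>) (b \<union> f ` u)) = c (insert (f \<rho>') (b \<union> f ` u))"
  using assms unfolding tail_uniform_def by blast

text \<open>
  A copy of the part of \<open>S\<close> above \<open>\<sigma>\<close> with root \<open>\<tau>\<close> that is tail-uniform relative to the sets \<open>B \<iota>\<close> and
  keeps the promise \<open>g\<close> about them. Promises are indexed by \<open>\<iota>\<close> instead of the set \<open>B \<iota>\<close> itself, so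
  that the same promise makes sense at different nodes \<open>\<tau>\<close>, where the sets are different.
\<close>

definition good_copy ::
    "('o::ordinals list set \<Rightarrow> 'c) \<Rightarrow> 'o list set \<Rightarrow> 'o list set \<Rightarrow> 'i set \<Rightarrow> ('i \<Rightarrow> 'o list set) \<Rightarrow>
     ('i \<Rightarrow> nat \<Rightarrow> 'c) \<Rightarrow> 'o list \<Rightarrow> 'o list \<Rightarrow> ('o list \<Rightarrow> 'o list) \<Rightarrow> bool" where
  "good_copy c S T I B g \<sigma> \<tau> f \<longleftrightarrow>
     f \<sigma> = \<tau> \<and> f ` cone S \<sigma> \<subseteq> T \<and> lx2_embedding f (cone S \<sigma>) \<and>
     (\<forall>\<iota>\<in>I. tail_uniform c (B \<iota>) f (cone S \<sigma>) \<and>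
        (\<forall>\<rho>\<in>cone S \<sigma>. c (insert (f \<rho>) (B \<iota>)) = g \<iota> (length \<rho>)))"

lemma good_copy_reindex:
  assumes "good_copy c S T I B g \<sigma> \<tau> f"
    and "\<And>\<iota>. \<iota> \<in> I' \<Longrightarrow> r \<iota> \<in> I \<and> B' \<iota> = B (r \<iota>) \<and> g' \<iota> = g (r \<iota>)"
  shows "good_copy c S T I' B' g' \<sigma> \<tau> f"
  using assms unfolding good_copy_def by auto

lemma cone_cases:
  assumes "\<eta> \<in> cone S \<sigma>" "\<forall>\<eta>\<in>S. \<forall>\<nu>. prefix \<nu> \<eta> \<longrightarrow> \<nu> \<in> S"
  obtains "\<eta> = \<sigma>"
    | \<alpha> \<zeta> where "\<eta> = \<sigma> @ \<alpha> # \<zeta>" "\<sigma> @ [\<alpha>] \<in> S" "\<eta> \<in> cone S (\<sigma> @ [\<alpha>])"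
proof -
  obtain \<zeta> where \<zeta>: "\<eta> = \<sigma> @ \<zeta>" "\<eta> \<in> S" using assms(1) by (auto simp: cone_def prefix_def)
  show ?thesis
  proof (cases \<zeta>)
    case Nil
    then show ?thesis using that(1) \<zeta> by simp
  next
    case (Cons \<alpha> \<zeta>')
    then have "\<eta> = \<sigma> @ \<alpha> # \<zeta>'" "prefix (\<sigma> @ [\<alpha>]) \<eta>" using \<zeta> by auto
    then show ?thesis using that(2) \<zeta>(2) assms(2) by (auto simp: cone_def)
  qed
qed

text \<open>
  Let \<open>\<eta>\<close> be the last element of \<open>u\<close>, above the child \<open>\<alpha>\<close> of \<open>\<sigma>\<close>. An end element \<open>\<rho>\<close> that branches off at
  the level of \<open>\<sigma>\<close> lies above a child further to the right; the colour is then the one promised by the copy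
  there, where all of \<open>u\<close> belongs to the copies on the left. This value is the same for all these
  children because \<open>P\<close> does not depend on the child. An end element that branches off later lies above \<open>\<alpha>\<close>
  as well; then the tail-uniformity of the copy there applies, relative to the part of \<open>u\<close> that lies
  above smaller children.
\<close>

lemma good_copy_glue:
  assumes S: "\<forall>\<eta>\<in>S. \<forall>\<nu>. prefix \<nu> \<eta> \<longrightarrow> \<nu> \<in> S"
    and \<sigma>: "\<sigma> \<in> S" "\<tau> \<in> T" "length \<tau> = length \<sigma>"
    and H: "\<And>\<alpha>. \<sigma> @ [\<alpha>] \<in> S \<Longrightarrow>
      good_copy c S T (I \<times> Fpow {\<eta> \<in> S. \<exists>\<beta><\<alpha>. prefix (\<sigma> @ [\<beta>]) \<eta>})
        (\<lambda>(\<iota>, w). B \<iota> \<union> F ` w) (\<lambda>(\<iota>, w). P \<iota> w) (\<sigma> @ [\<alpha>]) (\<tau> @ [x \<alpha>]) (H \<alpha>)"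
    and x: "\<And>\<alpha> \<beta>. \<sigma> @ [\<alpha>] \<in> S \<Longrightarrow> \<sigma> @ [\<beta>] \<in> S \<Longrightarrow> \<beta> < \<alpha> \<Longrightarrow> x \<beta> < x \<alpha>"
    and F: "F \<sigma> = \<tau>" "\<And>\<alpha> \<eta>. \<sigma> @ [\<alpha>] \<in> S \<Longrightarrow> \<eta> \<in> cone S (\<sigma> @ [\<alpha>]) \<Longrightarrow> F \<eta> = H \<alpha> \<eta>"
    and root: "\<And>\<iota>. \<iota> \<in> I \<Longrightarrow> c (insert \<tau> (B \<iota>)) = g \<iota> (length \<sigma>)"
    and g: "\<And>\<iota> \<rho>. \<iota> \<in> I \<Longrightarrow> \<rho> \<in> cone S \<sigma> \<Longrightarrow> \<rho> \<noteq> \<sigma> \<Longrightarrow> P \<iota> {} (length \<rho>) = g \<iota> (length \<rho>)"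
  shows "good_copy c S T I B g \<sigma> \<tau> F"
proof -
  note emb = H[unfolded good_copy_def, THEN conjunct2, THEN conjunct2, THEN conjunct1]
  note top = H[unfolded good_copy_def, THEN conjunct1]
  have H_T: "H \<alpha> \<eta> \<in> T" if "\<sigma> @ [\<alpha>] \<in> S" "\<eta> \<in> cone S (\<sigma> @ [\<alpha>])" for \<alpha> \<eta>
    using H[OF that(1)] that(2) unfolding good_copy_def by blast
  have H_unif: "tail_uniform c (B \<iota> \<union> F ` w) (H \<alpha>) (cone S (\<sigma> @ [\<alpha>]))"
    and H_prom: "\<rho> \<in> cone S (\<sigma> @ [\<alpha>]) \<Longrightarrow>
      c (insert (H \<alpha> \<rho>) (B \<iota> \<union> F ` w)) = P \<iota> w (length \<rho>)"
    if "\<sigma> @ [\<alpha>] \<in> S" "\<iota> \<in> I" "w \<in> Fpow {\<eta> \<in> S. \<exists>\<beta><\<alpha>. prefix (\<sigma> @ [\<beta>]) \<eta>}" for \<alpha> \<iota> w \<rho>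
    using H[OF that(1)] that(2,3) unfolding good_copy_def by auto
  have F_shape: "\<exists>\<zeta>'. F \<eta> = \<tau> @ x \<alpha> # \<zeta>' \<and> F \<eta> = H \<alpha> \<eta>"
    if "\<sigma> @ [\<alpha>] \<in> S" "\<eta> \<in> cone S (\<sigma> @ [\<alpha>])" for \<alpha> \<eta>
  proof -
    have "\<sigma> @ [\<alpha>] \<in> cone S (\<sigma> @ [\<alpha>])" using that(1) by (simp add: cone_def)
    moreover have "prefix (\<sigma> @ [\<alpha>]) \<eta>" using that(2) by (simp add: cone_def)
    ultimately have "prefix (H \<alpha> (\<sigma> @ [\<alpha>])) (H \<alpha> \<eta>)"
      using lx2_embeddingD(4)[OF emb[OF that(1)]] that(2) by blast
    then show ?thesis using top F that by (auto simp: prefix_def)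
  qed
  have F_emb: "length (F \<eta>) = length \<eta> \<and> lcp_length (F \<eta>) (F \<nu>) = lcp_length \<eta> \<nu> \<and>
    (lx2 \<eta> \<nu> \<longrightarrow> lx2 (F \<eta>) (F \<nu>))" if \<eta>: "\<eta> \<in> cone S \<sigma>" and \<nu>: "\<nu> \<in> cone S \<sigma>" for \<eta> \<nu>
  proof (cases rule: cone_cases[OF \<eta> S])
    case \<eta>': 1
    show ?thesis
    proof (cases rule: cone_cases[OF \<nu> S])
      case 1
      then show ?thesis using \<eta>' F(1) \<sigma>(3) by simp
    next
      case (2 \<alpha> \<zeta>)
      obtain \<zeta>' where "F \<nu> = \<tau> @ x \<alpha> # \<zeta>'" using F_shape[OF 2(2,3)] by blast
      then have "lcp_length \<tau> (F \<nu>) = length \<tau>" by simp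
      moreover have "lcp_length \<sigma> \<nu> = length \<sigma>" "\<not> lx2 \<sigma> \<nu>" using 2(1) by auto
      ultimately show ?thesis using \<eta>' F(1) \<sigma>(3) by simp
    qed
  next
    case (2 \<alpha> \<zeta>)
    note \<eta>' = 2
    have len: "length (F \<eta>) = length \<eta>"
      using lx2_embeddingD(1)[OF emb] F(2) \<eta>'(2,3) by metis
    obtain \<zeta>' where F\<eta>: "F \<eta> = \<tau> @ x \<alpha> # \<zeta>'" using F_shape[OF \<eta>'(2,3)] by blast
    show ?thesis
    proof (cases rule: cone_cases[OF \<nu> S])
      case 1
      have "lcp_length (F \<eta>) \<tau> = length \<tau>" "lx2 (F \<eta>) \<tau>" by (simp_all add: F\<eta>)
      moreover have "lcp_length \<eta> \<sigma> = length \<sigma>" using \<eta>'(1) by simp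
      ultimately show ?thesis using len 1 F(1) \<sigma>(3) by simp
    next
      case (2 \<beta> \<xi>)
      obtain \<xi>' where F\<nu>: "F \<nu> = \<tau> @ x \<beta> # \<xi>'" using F_shape[OF 2(2,3)] by blast
      show ?thesis
      proof (cases "\<alpha> = \<beta>")
        case True
        then show ?thesis
          using lx2_embeddingD[OF emb[OF 2(2)], of \<eta> \<nu>] F(2) 2 \<eta>' by auto
      next
        case False
        then have "x \<alpha> \<noteq> x \<beta>" "\<alpha> < \<beta> \<longrightarrow> x \<alpha> < x \<beta>"
          using x[OF \<eta>'(2) 2(2)] x[OF 2(2) \<eta>'(2)] linorder_neqE by fastforce+
        then have "lcp_length (F \<eta>) (F \<nu>) = length \<tau>" "\<alpha> < \<beta> \<longrightarrow> lx2 (F \<eta>) (F \<nu>)"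
          by (simp_all add: F\<eta> F\<nu>)
        moreover have "lcp_length \<eta> \<nu> = length \<sigma>" "lx2 \<eta> \<nu> \<longleftrightarrow> \<alpha> < \<beta>"
          using False \<eta>'(1) 2(1) by simp_all
        ultimately show ?thesis using len \<sigma>(3) by simp
      qed
    qed
  qed
  moreover have "F ` cone S \<sigma> \<subseteq> T"
  proof
    fix y assume "y \<in> F ` cone S \<sigma>"
    then obtain \<eta> where \<eta>: "\<eta> \<in> cone S \<sigma>" and y: "y = F \<eta>" by blast
    show "y \<in> T"
      by (cases rule: cone_cases[OF \<eta> S]) (use y F H_T \<sigma> in auto)
  qed
  moreover have "tail_uniform c (B \<iota>) F (cone S \<sigma>)" if \<iota>: "\<iota> \<in> I" for \<iota>
    unfolding tail_uniform_def
  proof (intro allI impI, elim conjE)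
    fix u \<eta> \<rho> \<rho>'
    assume u: "finite u" "u \<subseteq> cone S \<sigma>" "\<eta> \<in> u" "\<forall>\<nu>\<in>u. \<nu> = \<eta> \<or> lx2 \<nu> \<eta>"
      and \<rho>: "\<rho> \<in> cone S \<sigma>" "\<rho>' \<in> cone S \<sigma>" "lx2 \<eta> \<rho>" "lx2 \<eta> \<rho>'"
        "length \<rho> = length \<rho>'" "lcp_length \<eta> \<rho> = lcp_length \<eta> \<rho>'"
    show "c (insert (F \<rho>) (B \<iota> \<union> F ` u)) = c (insert (F \<rho>') (B \<iota> \<union> F ` u))"
    proof (cases "\<rho> = \<sigma> \<or> \<rho>' = \<sigma>")
      case True
      then have "\<rho> = \<rho>'" using \<rho>(1,2,5) by (auto simp: cone_def prefix_def)
      then show ?thesis by simp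
    next
      case False
      have \<eta>_cone: "\<eta> \<in> cone S \<sigma>" using u by blast
      obtain \<alpha> \<zeta> where \<eta>: "\<eta> = \<sigma> @ \<alpha> # \<zeta>" "\<sigma> @ [\<alpha>] \<in> S" "\<eta> \<in> cone S (\<sigma> @ [\<alpha>])"
      proof (cases rule: cone_cases[OF \<eta>_cone S])
        case 1
        then have "\<not> lx2 \<eta> \<rho>" using \<rho>(1) by (auto simp: cone_def prefix_def)
        then show ?thesis using \<rho>(3) by blast
      qed (rule that)
      obtain \<beta> \<xi> where \<beta>: "\<rho> = \<sigma> @ \<beta> # \<xi>" "\<sigma> @ [\<beta>] \<in> S" "\<rho> \<in> cone S (\<sigma> @ [\<beta>])"
        using cone_cases[OF \<rho>(1) S] False by metis
      obtain \<beta>' \<xi>' where \<beta>': "\<rho>' = \<sigma> @ \<beta>' # \<xi>'" "\<sigma> @ [\<beta>'] \<in> S" "\<rho>' \<in> cone S (\<sigma> @ [\<beta>'])"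
        using cone_cases[OF \<rho>(2) S] False by metis
      have le: "\<alpha> \<le> \<beta>" "\<alpha> \<le> \<beta>'" using \<rho>(3,4) \<eta>(1) \<beta>(1) \<beta>'(1) by auto
      have branch: "\<alpha> = \<beta> \<longleftrightarrow> \<alpha> = \<beta>'" using \<rho>(6) \<eta>(1) \<beta>(1) \<beta>'(1) by (auto split: if_splits)
      have u_left: "\<exists>\<gamma>\<le>\<alpha>. prefix (\<sigma> @ [\<gamma>]) \<nu>" if "\<nu> \<in> u" for \<nu>
      proof -
        have \<nu>: "\<nu> \<in> cone S \<sigma>" "\<nu> = \<eta> \<or> lx2 \<nu> \<eta>" using that u by auto
        show ?thesis
          by (cases rule: cone_cases[OF \<nu>(1) S]) (use \<open>\<nu> = \<eta> \<or> lx2 \<nu> \<eta>\<close> \<eta>(1) in auto)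
      qed
      have u_S: "u \<subseteq> S" using u(2) by (auto simp: cone_def)
      show ?thesis
      proof (cases "\<alpha> = \<beta>")
        case False
        have "u \<in> Fpow {\<eta> \<in> S. \<exists>\<gamma><\<delta>. prefix (\<sigma> @ [\<gamma>]) \<eta>}" if "\<alpha> < \<delta>" for \<delta>
        proof -
          have "\<exists>\<gamma><\<delta>. prefix (\<sigma> @ [\<gamma>]) \<nu>" if "\<nu> \<in> u" for \<nu>
            using u_left[OF that] \<open>\<alpha> < \<delta>\<close> order_le_less_trans by blast
          then show ?thesis using u(1) u_S by (auto simp: Fpow_def)
        qed
        moreover have "\<alpha> < \<beta>" "\<alpha> < \<beta>'" using False branch le by auto
        ultimately have "c (insert (H \<beta> \<rho>) (B \<iota> \<union> F ` u)) = P \<iota> u (length \<rho>)"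
          "c (insert (H \<beta>' \<rho>') (B \<iota> \<union> F ` u)) = P \<iota> u (length \<rho>')"
          using H_prom[OF _ \<iota>] \<beta>(2,3) \<beta>'(2,3) by auto
        then show ?thesis using F(2) \<beta>(2,3) \<beta>'(2,3) \<rho>(5) by simp
      next
        case True
        then have "\<beta>' = \<alpha>" using branch by simp
        define w where "w = {\<nu> \<in> u. \<exists>\<gamma><\<alpha>. prefix (\<sigma> @ [\<gamma>]) \<nu>}"
        define v where "v = u \<inter> cone S (\<sigma> @ [\<alpha>])"
        have "w \<in> Fpow {\<eta> \<in> S. \<exists>\<gamma><\<alpha>. prefix (\<sigma> @ [\<gamma>]) \<eta>}"
          using u(1) u_S by (auto simp: w_def Fpow_def)
        note unif = H_unif[OF \<eta>(2) \<iota> this]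
        have "c (insert (H \<alpha> \<rho>) ((B \<iota> \<union> F ` w) \<union> H \<alpha> ` v)) =
          c (insert (H \<alpha> \<rho>') ((B \<iota> \<union> F ` w) \<union> H \<alpha> ` v))"
          by (rule tail_uniformD[OF unif, of v \<eta>])
            (use u \<eta> \<rho> \<beta>(3) \<beta>'(3) True \<open>\<beta>' = \<alpha>\<close> in \<open>auto simp: v_def\<close>)
        moreover have "u = w \<union> v"
          using u_left u_S unfolding w_def v_def cone_def order_le_less by blast
        moreover have "H \<alpha> ` v = F ` v"
          using F(2)[OF \<eta>(2)] by (auto simp: v_def intro!: image_eqI)
        ultimately show ?thesis
          using F(2)[OF \<eta>(2)] \<beta>(3) \<beta>'(3) True \<open>\<beta>' = \<alpha>\<close> by (simp add: image_Un Un_assoc)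
      qed
    qed
  qed
  moreover have "c (insert (F \<rho>) (B \<iota>)) = g \<iota> (length \<rho>)"
    if \<iota>: "\<iota> \<in> I" and \<rho>: "\<rho> \<in> cone S \<sigma>" for \<iota> \<rho>
  proof (cases rule: cone_cases[OF \<rho> S])
    case 1
    then show ?thesis using root[OF \<iota>] F(1) by simp
  next
    case (2 \<alpha> \<zeta>)
    then have "c (insert (H \<alpha> \<rho>) (B \<iota> \<union> F ` {})) = P \<iota> {} (length \<rho>)"
      by (intro H_prom \<iota>) (auto simp: Fpow_def)
    then show ?thesis using F(2)[OF 2(2,3)] g[OF \<iota> \<rho>] 2(1) by simp
  qed
  ultimately show ?thesis
    unfolding good_copy_def lx2_embedding_def using F(1) by auto
qed


section \<open>Gluing copies of the subtrees at the children of a node\<close>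

text \<open>
  In this locale, \<open>copies G\<close> is a canonical way of choosing copies above increasing
  elements of \<open>X\<close> so that \<open>good_copy_glue\<close> applies. Here a promise \<open>G\<close> is about arbitrary
  finite sets of nodes: which sets matter at a child \<open>\<alpha>\<close> becomes clear only when the copies
  to the left have been chosen.
\<close>

locale copy_recursion =
  fixes c :: "'o::ordinals list set \<Rightarrow> 'c" and S T :: "'o list set"
    and I :: "'i set" and B :: "'i \<Rightarrow> 'o list set" and \<sigma> \<tau> :: "'o list" and X :: "'o set"
  assumes S: "\<forall>\<eta>\<in>S. \<forall>\<nu>. prefix \<nu> \<eta> \<longrightarrow> \<nu> \<in> S"
    and \<sigma>: "\<sigma> \<in> S" and \<tau>: "\<tau> \<in> T" and len: "length \<tau> = length \<sigma>"
    and B: "\<And>\<iota>. \<iota> \<in> I \<Longrightarrow> B \<iota> \<in> Fpow T"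
begin

definition left :: "'o \<Rightarrow> 'o list set" where
  "left \<alpha> = {\<eta> \<in> S. \<exists>\<beta><\<alpha>. prefix (\<sigma> @ [\<beta>]) \<eta>}"

definition assemble :: "('o \<Rightarrow> 'o list \<Rightarrow> 'o list) \<Rightarrow> 'o list \<Rightarrow> 'o list" where
  "assemble R \<eta> = (if \<eta> = \<sigma> then \<tau> else R (\<eta> ! length \<sigma>) \<eta>)"

definition candidate ::
    "('o list set \<Rightarrow> nat \<Rightarrow> 'c) \<Rightarrow> ('o \<Rightarrow> 'o list \<Rightarrow> 'o list) \<Rightarrow> 'o \<Rightarrow> ('o list \<Rightarrow> 'o list) \<Rightarrow> bool" where
  "candidate G R \<alpha> f \<longleftrightarrow> (\<exists>x\<in>X.
     (\<forall>\<beta><\<alpha>. \<sigma> @ [\<beta>] \<in> S \<longrightarrow> R \<beta> (\<sigma> @ [\<beta>]) ! length \<sigma> < x) \<and>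
     good_copy c S T (I \<times> Fpow (left \<alpha>)) (\<lambda>(\<iota>, w). B \<iota> \<union> assemble R ` w)
       (\<lambda>(\<iota>, w). G (B \<iota> \<union> assemble R ` w)) (\<sigma> @ [\<alpha>]) (\<tau> @ [x]) f)"

text \<open>
  If no candidate exists, the value is arbitrary. Thus \<open>copies G\<close> is defined for all \<open>G\<close>,
  whether or not the recursion succeeds.
\<close>

definition copies :: "('o list set \<Rightarrow> nat \<Rightarrow> 'c) \<Rightarrow> 'o \<Rightarrow> 'o list \<Rightarrow> 'o list" where
  "copies G = wfrec {(\<beta>, \<alpha>). \<beta> < \<alpha>} (\<lambda>R \<alpha>. SOME f. candidate G R \<alpha> f)"

lemma assemble_left: "\<eta> \<in> left \<alpha> \<Longrightarrow> \<exists>\<beta><\<alpha>. \<sigma> @ [\<beta>] \<in> S \<and> \<eta> \<in> cone S (\<sigma> @ [\<beta>]) \<and> assemble R \<eta> = R \<beta> \<eta>"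
  using S by (auto simp: left_def assemble_def cone_def prefix_def)

lemma candidate_transfer:
  assumes R: "\<And>\<beta>. \<beta> < \<alpha> \<Longrightarrow> R \<beta> = R' \<beta>"
    and G: "\<And>\<iota> w. \<iota> \<in> I \<Longrightarrow> w \<in> Fpow (left \<alpha>) \<Longrightarrow>
      G (B \<iota> \<union> assemble R ` w) = G' (B \<iota> \<union> assemble R' ` w)"
    and cand: "candidate G R \<alpha> f"
  shows "candidate G' R' \<alpha> f"
proof -
  have "assemble R ` w = assemble R' ` w" if "w \<in> Fpow (left \<alpha>)" for w
  proof (rule image_cong)
    fix \<eta> assume "\<eta> \<in> w"
    then have "\<eta> \<in> left \<alpha>" using that by (auto simp: Fpow_def)
    then show "assemble R \<eta> = assemble R' \<eta>"
      using R by (auto simp: assemble_def left_def prefix_def)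
  qed simp
  moreover obtain x where "x \<in> X" "\<forall>\<beta><\<alpha>. \<sigma> @ [\<beta>] \<in> S \<longrightarrow> R \<beta> (\<sigma> @ [\<beta>]) ! length \<sigma> < x"
    "good_copy c S T (I \<times> Fpow (left \<alpha>)) (\<lambda>(\<iota>, w). B \<iota> \<union> assemble R ` w)
       (\<lambda>(\<iota>, w). G (B \<iota> \<union> assemble R ` w)) (\<sigma> @ [\<alpha>]) (\<tau> @ [x]) f"
    using cand unfolding candidate_def by blast
  ultimately show ?thesis
    unfolding candidate_def
  proof (intro bexI[of _ x] conjI allI impI)
    assume asm: "\<And>w. w \<in> Fpow (left \<alpha>) \<Longrightarrow> assemble R ` w = assemble R' ` w"
      and below: "\<forall>\<beta><\<alpha>. \<sigma> @ [\<beta>] \<in> S \<longrightarrow> R \<beta> (\<sigma> @ [\<beta>]) ! length \<sigma> < x"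
      and good: "good_copy c S T (I \<times> Fpow (left \<alpha>)) (\<lambda>(\<iota>, w). B \<iota> \<union> assemble R ` w)
        (\<lambda>(\<iota>, w). G (B \<iota> \<union> assemble R ` w)) (\<sigma> @ [\<alpha>]) (\<tau> @ [x]) f"
    show "R' \<beta> (\<sigma> @ [\<beta>]) ! length \<sigma> < x" if "\<beta> < \<alpha>" "\<sigma> @ [\<beta>] \<in> S" for \<beta>
      using below that R[OF that(1)] by metis
    have "G' (B \<iota> \<union> assemble R' ` w) = G (B \<iota> \<union> assemble R ` w)"
      "B \<iota> \<union> assemble R' ` w = B \<iota> \<union> assemble R ` w"
      if "\<iota> \<in> I" "w \<in> Fpow (left \<alpha>)" for \<iota> w
      using G[OF that] asm[OF that(2)] by simp_all
    then show "good_copy c S T (I \<times> Fpow (left \<alpha>)) (\<lambda>(\<iota>, w). B \<iota> \<union> assemble R' ` w)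
        (\<lambda>(\<iota>, w). G' (B \<iota> \<union> assemble R' ` w)) (\<sigma> @ [\<alpha>]) (\<tau> @ [x]) f"
      by (intro good_copy_reindex[OF good, where r = "\<lambda>p. p"]) (simp add: split_beta mem_Times_iff)
  qed
qed

lemma copies_eq: "copies G \<alpha> = (SOME f. candidate G (copies G) \<alpha> f)"
proof -
  have "candidate G (cut (copies G) {(\<beta>, \<alpha>). \<beta> < \<alpha>} \<alpha>) \<alpha> = candidate G (copies G) \<alpha>"
  proof (intro ext iffI)
    fix f
    have asm: "assemble (cut (copies G) {(\<beta>, \<alpha>). \<beta> < \<alpha>} \<alpha>) ` w = assemble (copies G) ` w"
      if "w \<in> Fpow (left \<alpha>)" for w
      using that by (intro image_cong)
        (auto simp: assemble_def left_def prefix_def cut_apply Fpow_def)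
    show "candidate G (copies G) \<alpha> f" if "candidate G (cut (copies G) {(\<beta>, \<alpha>). \<beta> < \<alpha>} \<alpha>) \<alpha> f"
      using candidate_transfer[OF _ _ that] asm by (simp add: cut_apply)
    show "candidate G (cut (copies G) {(\<beta>, \<alpha>). \<beta> < \<alpha>} \<alpha>) \<alpha> f" if "candidate G (copies G) \<alpha> f"
      using candidate_transfer[OF _ _ that] asm by (simp add: cut_apply)
  qed
  then show ?thesis
    unfolding copies_def by (subst wfrec[OF wf]) simp
qed

text \<open>
  The recursion consults \<open>G\<close> only at sets that are formed from its own earlier choices. So two
  promises lead to the same choices if they agree on corresponding sets, although these sets are not
  known to be equal in advance.
\<close>

lemma copies_determined:
  assumes "\<And>\<iota> w. \<iota> \<in> I \<Longrightarrow> w \<in> Fpow S \<Longrightarrow>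
      G (B \<iota> \<union> assemble (copies G) ` w) = G' (B \<iota> \<union> assemble (copies G') ` w)"
  shows "copies G \<alpha> = copies G' \<alpha>"
proof (induction \<alpha> rule: less_induct)
  case (less \<alpha>)
  have "w \<in> Fpow S" if "w \<in> Fpow (left \<alpha>)" for w
    using that by (auto simp: Fpow_def left_def)
  then have "candidate G (copies G) \<alpha> = candidate G' (copies G') \<alpha>"
    using candidate_transfer[of \<alpha> "copies G" "copies G'" G G']
      candidate_transfer[of \<alpha> "copies G'" "copies G" G' G] less assms
    by (intro ext iffI) simp_all
  then show ?case by (subst (1 2) copies_eq) simp
qed

text \<open>
  The recursion cannot get stuck: at every child \<open>\<alpha>\<close> the copy above \<open>\<tau> @ [x]\<close> is a
  candidate, because \<open>x\<close> exceeds all choices made below and \<open>\<B>\<close> contains all sets formed from them.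
\<close>

lemma good_copy_copies:
  assumes x: "x \<in> X" "\<And>\<eta>. \<eta> \<in> S \<Longrightarrow> assemble (copies G) \<eta> ! length \<sigma> \<in> X \<Longrightarrow>
      assemble (copies G) \<eta> ! length \<sigma> < x"
    and child: "\<And>\<alpha>. \<sigma> @ [\<alpha>] \<in> S \<Longrightarrow> \<exists>f. good_copy c S T \<B> (\<lambda>b. b) G (\<sigma> @ [\<alpha>]) (\<tau> @ [x]) f"
    and \<B>: "\<And>\<iota> w. \<iota> \<in> I \<Longrightarrow> w \<in> Fpow S \<Longrightarrow> B \<iota> \<union> assemble (copies G) ` w \<in> Fpow T \<Longrightarrow>
      B \<iota> \<union> assemble (copies G) ` w \<in> \<B>"
    and root: "\<And>\<iota>. \<iota> \<in> I \<Longrightarrow> c (insert \<tau> (B \<iota>)) = g \<iota> (length \<sigma>)"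
    and g: "\<And>\<iota> \<rho>. \<iota> \<in> I \<Longrightarrow> \<rho> \<in> cone S \<sigma> \<Longrightarrow> \<rho> \<noteq> \<sigma> \<Longrightarrow> G (B \<iota>) (length \<rho>) = g \<iota> (length \<rho>)"
  shows "good_copy c S T I B g \<sigma> \<tau> (assemble (copies G))"
proof -
  define F where "F = assemble (copies G)"
  have cand: "candidate G (copies G) \<alpha> (copies G \<alpha>)" if "\<sigma> @ [\<alpha>] \<in> S" for \<alpha>
    using that
  proof (induction \<alpha> rule: less_induct)
    case (less \<alpha>)
    have earlier: "copies G \<beta> (\<sigma> @ [\<beta>]) ! length \<sigma> < x" "copies G \<beta> ` cone S (\<sigma> @ [\<beta>]) \<subseteq> T"
      if \<beta>: "\<beta> < \<alpha>" "\<sigma> @ [\<beta>] \<in> S" for \<beta>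
    proof -
      obtain y where y: "y \<in> X" "copies G \<beta> (\<sigma> @ [\<beta>]) = \<tau> @ [y]"
        and "copies G \<beta> ` cone S (\<sigma> @ [\<beta>]) \<subseteq> T"
        using less.IH[OF \<beta>] unfolding candidate_def good_copy_def by blast
      then show "copies G \<beta> ` cone S (\<sigma> @ [\<beta>]) \<subseteq> T" by simp
      have "assemble (copies G) (\<sigma> @ [\<beta>]) ! length \<sigma> = y"
        using y(2) len by (simp add: assemble_def nth_append)
      then show "copies G \<beta> (\<sigma> @ [\<beta>]) ! length \<sigma> < x"
        using x(2)[OF \<beta>(2)] y len by (simp add: nth_append)
    qed
    obtain f where f: "good_copy c S T \<B> (\<lambda>b. b) G (\<sigma> @ [\<alpha>]) (\<tau> @ [x]) f"
      using child[OF less.prems] by blast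
    have "B \<iota> \<union> F ` w \<in> \<B>" if "\<iota> \<in> I" "w \<in> Fpow (left \<alpha>)" for \<iota> w
    proof -
      have "F \<eta> \<in> T" if "\<eta> \<in> w" for \<eta>
      proof -
        have "\<eta> \<in> left \<alpha>" using that \<open>w \<in> Fpow (left \<alpha>)\<close> by (auto simp: Fpow_def)
        then show ?thesis
          using assemble_left[of \<eta> \<alpha> "copies G"] earlier(2) unfolding F_def by fastforce
      qed
      then have "B \<iota> \<union> F ` w \<in> Fpow T" "w \<in> Fpow S"
        using B[OF that(1)] that(2) by (auto simp: Fpow_def left_def)
      then show ?thesis unfolding F_def using \<B> that(1) by blast
    qed
    then have "good_copy c S T (I \<times> Fpow (left \<alpha>)) (\<lambda>(\<iota>, w). B \<iota> \<union> F ` w)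
       (\<lambda>(\<iota>, w). G (B \<iota> \<union> F ` w)) (\<sigma> @ [\<alpha>]) (\<tau> @ [x]) f"
      by (intro good_copy_reindex[OF f, where r = "\<lambda>(\<iota>, w). B \<iota> \<union> F ` w"]) auto
    then have "candidate G (copies G) \<alpha> f"
      unfolding candidate_def F_def using x(1) earlier(1) by blast
    then have "candidate G (copies G) \<alpha> (SOME f. candidate G (copies G) \<alpha> f)"
      by (rule someI[of "candidate G (copies G) \<alpha>"])
    then show ?case by (simp only: copies_eq[symmetric])
  qed
  have "\<exists>x. \<forall>\<alpha>. \<sigma> @ [\<alpha>] \<in> S \<longrightarrow>
     (\<forall>\<beta><\<alpha>. \<sigma> @ [\<beta>] \<in> S \<longrightarrow> copies G \<beta> (\<sigma> @ [\<beta>]) ! length \<sigma> < x \<alpha>) \<and>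
     good_copy c S T (I \<times> Fpow (left \<alpha>)) (\<lambda>(\<iota>, w). B \<iota> \<union> F ` w)
       (\<lambda>(\<iota>, w). G (B \<iota> \<union> F ` w)) (\<sigma> @ [\<alpha>]) (\<tau> @ [x \<alpha>]) (copies G \<alpha>)"
    by (intro choice allI) (use cand in \<open>unfold candidate_def F_def, blast\<close>)
  then obtain y where mono: "\<And>\<alpha> \<beta>. \<sigma> @ [\<alpha>] \<in> S \<Longrightarrow> \<beta> < \<alpha> \<Longrightarrow> \<sigma> @ [\<beta>] \<in> S \<Longrightarrow>
      copies G \<beta> (\<sigma> @ [\<beta>]) ! length \<sigma> < y \<alpha>"
    and y: "\<And>\<alpha>. \<sigma> @ [\<alpha>] \<in> S \<Longrightarrow>
      good_copy c S T (I \<times> Fpow (left \<alpha>)) (\<lambda>(\<iota>, w). B \<iota> \<union> F ` w)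
       (\<lambda>(\<iota>, w). G (B \<iota> \<union> F ` w)) (\<sigma> @ [\<alpha>]) (\<tau> @ [y \<alpha>]) (copies G \<alpha>)"
    by blast
  show ?thesis
    unfolding F_def[symmetric]
  proof (rule good_copy_glue[where P = "\<lambda>\<iota> w. G (B \<iota> \<union> F ` w)" and x = y and H = "copies G"])
    show "y \<beta> < y \<alpha>" if "\<sigma> @ [\<alpha>] \<in> S" "\<sigma> @ [\<beta>] \<in> S" "\<beta> < \<alpha>" for \<alpha> \<beta>
    proof -
      have "copies G \<beta> (\<sigma> @ [\<beta>]) = \<tau> @ [y \<beta>]"
        using y[OF that(2)] unfolding good_copy_def by blast
      then show ?thesis using mono[OF that(1,3,2)] len by (simp add: nth_append)
    qed
    show "F \<eta> = copies G \<alpha> \<eta>" if "\<sigma> @ [\<alpha>] \<in> S" "\<eta> \<in> cone S (\<sigma> @ [\<alpha>])" for \<alpha> \<eta>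
      using that by (auto simp: F_def assemble_def cone_def prefix_def nth_append)
  qed (use S \<sigma> \<tau> len y root g in \<open>auto simp: left_def F_def assemble_def\<close>)
qed

text \<open>
  There are many promises \<open>G\<close>, but by \<open>copies_determined\<close> only as many systems of copies as there are
  functions from \<open>I \<times> Fpow S \<times> \<nat>\<close> to \<open>C\<close>.
\<close>

lemma copies_lepoll:
  assumes "infinite K" "I \<lesssim> K" "Fpow S \<lesssim> K" "C \<lesssim> K"
  shows "copies ` {G. \<forall>b l. G b l \<in> C} \<lesssim> Pow K"
proof -
  \<comment> \<open>The graph of the part of \<open>G\<close> that the recursion consults.\<close>
  define code where "code G = {(\<iota>, w, l, G (B \<iota> \<union> assemble (copies G) ` w) l) | \<iota> w l.
      \<iota> \<in> I \<and> w \<in> Fpow S}" for G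
  have "copies G = copies G'" if "code G = code G'" for G G'
  proof
    show "copies G \<alpha> = copies G' \<alpha>" for \<alpha>
    proof (rule copies_determined, rule ext)
      fix \<iota> w l assume "\<iota> \<in> I" "w \<in> Fpow S"
      then have "(\<iota>, w, l, G (B \<iota> \<union> assemble (copies G) ` w) l) \<in> code G'"
        unfolding that[symmetric] by (auto simp: code_def)
      then show "G (B \<iota> \<union> assemble (copies G) ` w) l = G' (B \<iota> \<union> assemble (copies G') ` w) l"
        by (auto simp: code_def)
    qed
  qed
  then have "copies ` {G. \<forall>b l. G b l \<in> C} \<lesssim> code ` {G. \<forall>b l. G b l \<in> C}"
    by (intro image_lepoll_image) blast
  also have "\<dots> \<lesssim> Pow (I \<times> Fpow S \<times> (UNIV :: nat set) \<times> C)"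
    by (intro subset_imp_lepoll) (auto simp: code_def)
  also have "\<dots> \<lesssim> Pow K"
    using assms by (intro Pow_lepoll_mono Times_lepoll) (simp_all add: infinite_le_lepoll[symmetric])
  finally show ?thesis .
qed

end

text \<open>
  To keep a promise about the sets \<open>B \<iota>\<close> above \<open>\<tau>\<close> it suffices to keep, for each child separately, a
  compatible promise about the sets in \<open>\<B>\<close> above \<open>\<tau>'\<close>. The colours that involve the root \<open>\<tau>\<close> itself cannot
  be influenced; that they are as promised is a premise.
\<close>

definition controls ::
    "('o::ordinals list set \<Rightarrow> 'c) \<Rightarrow> 'o list set \<Rightarrow> 'o list set \<Rightarrow> 'i set \<Rightarrow> ('i \<Rightarrow> 'o list set) \<Rightarrow>
     'c set \<Rightarrow> 'o list \<Rightarrow> 'o list \<Rightarrow> 'o list set set \<Rightarrow> bool" where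
  "controls c S T I B C \<tau> \<tau>' \<B> \<longleftrightarrow>
    (\<forall>\<sigma>\<in>S. \<forall>G g. length \<sigma> = length \<tau> \<longrightarrow> (\<forall>b l. G b l \<in> C) \<longrightarrow>
       (\<forall>\<alpha>. \<sigma> @ [\<alpha>] \<in> S \<longrightarrow> (\<exists>f. good_copy c S T \<B> (\<lambda>b. b) G (\<sigma> @ [\<alpha>]) \<tau>' f)) \<longrightarrow>
       (\<forall>\<iota>\<in>I. c (insert \<tau> (B \<iota>)) = g \<iota> (length \<sigma>)) \<longrightarrow>
       (\<forall>\<iota>\<in>I. \<forall>\<rho>\<in>cone S \<sigma>. \<rho> \<noteq> \<sigma> \<longrightarrow> G (B \<iota>) (length \<rho>) = g \<iota> (length \<rho>)) \<longrightarrow>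
       (\<exists>f. good_copy c S T I B g \<sigma> \<tau> f))"

text \<open>
  The family \<open>\<B>\<close> consists of all sets that are formed from any of the canonical systems of copies,
  for all nodes \<open>\<sigma>\<close> of the level at once, and \<open>x\<close> is chosen above all elements of \<open>X\<close> that these systems
  use.
\<close>

lemma copies_extend:
  fixes c :: "'o::ordinals list set \<Rightarrow> 'c" and B :: "'i \<Rightarrow> 'o list set"
  assumes S: "\<forall>\<eta>\<in>S. \<forall>\<nu>. prefix \<nu> \<eta> \<longrightarrow> \<nu> \<in> S" and \<tau>: "\<tau> \<in> T"
    and B: "\<forall>\<iota>\<in>I. B \<iota> \<in> Fpow T"
    and K: "infinite K" "I \<lesssim> K" "Pow S \<lesssim> K" "C \<lesssim> K" "Pow K \<lesssim> L"
    and X: "\<forall>Y\<subseteq>X. Y \<lesssim> L \<longrightarrow> (\<exists>x\<in>X. \<forall>y\<in>Y. y < x)"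
  shows "\<exists>x\<in>X. \<exists>\<B>. \<B> \<subseteq> Fpow T \<and> \<B> \<lesssim> L \<and> controls c S T I B C \<tau> (\<tau> @ [x]) \<B>"
proof -
  define \<G> where "\<G> = {G :: 'o list set \<Rightarrow> nat \<Rightarrow> 'c. \<forall>b l. G b l \<in> C}"
  define S' where "S' = {\<sigma> \<in> S. length \<tau> = length \<sigma>}"
  define H where "H \<sigma> = copy_recursion.copies c S T I B \<sigma> \<tau> X" for \<sigma>
  define asm where "asm \<sigma> = copy_recursion.assemble \<sigma> \<tau>" for \<sigma>
  have loc: "copy_recursion S T I B \<sigma> \<tau>" if "\<sigma> \<in> S'" for \<sigma>
    using that S \<tau> B by unfold_locales (auto simp: S'_def)
  have "S \<lesssim> K" "Fpow S \<lesssim> K"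
    by (rule lepoll_trans[OF _ K(3)], rule lepoll_Pow_self)
      (rule lepoll_trans[OF subset_imp_lepoll K(3)], rule Fpow_subset_Pow)
  have "K \<lesssim> L" by (rule lepoll_trans[OF lepoll_Pow_self K(5)])
  then have L: "infinite L" "I \<lesssim> L" "S \<lesssim> L" "Fpow S \<lesssim> L"
    using K(1,2) \<open>S \<lesssim> K\<close> \<open>Fpow S \<lesssim> K\<close>
    by (auto intro: lepoll_trans simp: infinite_le_lepoll)
  have H_lepoll: "H \<sigma> ` \<G> \<lesssim> L" if "\<sigma> \<in> S'" for \<sigma>
    using copy_recursion.copies_lepoll[OF loc[OF that] K(1,2) \<open>Fpow S \<lesssim> K\<close> K(4)] K(5)
    unfolding H_def \<G>_def by (rule lepoll_trans)
  define Y where "Y = {y \<in> X. \<exists>\<sigma>\<in>S'. \<exists>h\<in>H \<sigma> ` \<G>. \<exists>\<eta>\<in>S. y = asm \<sigma> h \<eta> ! length \<sigma>}"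
  define \<B> where "\<B> = {b \<in> Fpow T. \<exists>\<sigma>\<in>S'. \<exists>h\<in>H \<sigma> ` \<G>. \<exists>\<iota>\<in>I. \<exists>w\<in>Fpow S.
    b = B \<iota> \<union> asm \<sigma> h ` w}"
  have S': "S' \<lesssim> L"
    by (rule lepoll_trans[OF subset_imp_lepoll L(3)]) (auto simp: S'_def)
  have "Y \<subseteq> (\<Union>\<sigma>\<in>S'. (\<lambda>(h, \<eta>). asm \<sigma> h \<eta> ! length \<sigma>) ` (H \<sigma> ` \<G> \<times> S))"
    unfolding Y_def by force
  moreover have "\<dots> \<lesssim> L"
    by (rule UN_lepoll[OF L(1) S'], rule lepoll_trans[OF image_lepoll],
        intro Times_lepoll[OF L(1)] H_lepoll L)
  ultimately have "Y \<lesssim> L" by (rule lepoll_trans[OF subset_imp_lepoll])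
  moreover have "Y \<subseteq> X" by (auto simp: Y_def)
  ultimately obtain x where x: "x \<in> X" "\<forall>y\<in>Y. y < x" using X by blast
  have "\<B> \<subseteq> (\<Union>\<sigma>\<in>S'. (\<lambda>(h, \<iota>, w). B \<iota> \<union> asm \<sigma> h ` w) ` (H \<sigma> ` \<G> \<times> I \<times> Fpow S))"
    unfolding \<B>_def by force
  moreover have "\<dots> \<lesssim> L"
    by (rule UN_lepoll[OF L(1) S'], rule lepoll_trans[OF image_lepoll],
        intro Times_lepoll[OF L(1)] H_lepoll L)
  ultimately have "\<B> \<lesssim> L" by (rule lepoll_trans[OF subset_imp_lepoll])
  have controlled: "\<exists>f. good_copy c S T I B g \<sigma> \<tau> f"
    if \<sigma>: "\<sigma> \<in> S" "length \<sigma> = length \<tau>" and G: "\<forall>b l. G b l \<in> C"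
      and child: "\<forall>\<alpha>. \<sigma> @ [\<alpha>] \<in> S \<longrightarrow>
        (\<exists>f. good_copy c S T \<B> (\<lambda>b. b) G (\<sigma> @ [\<alpha>]) (\<tau> @ [x]) f)"
      and root: "\<forall>\<iota>\<in>I. c (insert \<tau> (B \<iota>)) = g \<iota> (length \<sigma>)"
      and g: "\<forall>\<iota>\<in>I. \<forall>\<rho>\<in>cone S \<sigma>. \<rho> \<noteq> \<sigma> \<longrightarrow> G (B \<iota>) (length \<rho>) = g \<iota> (length \<rho>)" for \<sigma> G g
  proof -
    have "\<sigma> \<in> S'" using \<sigma> by (simp add: S'_def)
    interpret copy_recursion c S T I B \<sigma> \<tau> X by (rule loc[OF \<open>\<sigma> \<in> S'\<close>])
    have H: "copies G \<in> H \<sigma> ` \<G>" using G by (auto simp: H_def \<G>_def)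
    have "good_copy c S T I B g \<sigma> \<tau> (assemble (copies G))"
    proof (rule good_copy_copies[OF x(1), where \<B> = \<B>])
      show "assemble (copies G) \<eta> ! length \<sigma> < x"
        if "\<eta> \<in> S" "assemble (copies G) \<eta> ! length \<sigma> \<in> X" for \<eta>
        using that x(2) H \<open>\<sigma> \<in> S'\<close> unfolding Y_def asm_def by blast
      show "B \<iota> \<union> assemble (copies G) ` w \<in> \<B>"
        if "\<iota> \<in> I" "w \<in> Fpow S" "B \<iota> \<union> assemble (copies G) ` w \<in> Fpow T" for \<iota> w
        using that H \<open>\<sigma> \<in> S'\<close> unfolding \<B>_def asm_def by blast
    qed (use child root g in auto)
    then show ?thesis by blast
  qed
  have "controls c S T I B C \<tau> (\<tau> @ [x]) \<B>"
    unfolding controls_def by (intro ballI allI impI, rule controlled)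
  moreover note \<open>\<B> \<lesssim> L\<close>
  ultimately show ?thesis
    using x(1) by (intro bexI[of _ x] exI[of _ \<B>]) (auto simp: \<B>_def)
qed


section \<open>Large types and the tail-uniform copy\<close>

text \<open>
  The sequence \<open>a\<close> bounds the number of sets that are controlled at each level of the tree. That
  \<open>Pow S\<close> and not just \<open>S\<close> is bounded by \<open>a 0\<close> is a cheap way to bound the set of finite subsets of \<open>S\<close>.
\<close>

locale colouring =
  fixes S :: "'o::ordinals list set" and \<mu> \<chi> :: 'o and a :: "nat \<Rightarrow> 'o"
    and c :: "'o list set \<Rightarrow> 'o"
  assumes S: "tree S"
    and infinite_a: "infinite {..<a 0}" and Pow_S: "Pow S \<lesssim> {..<a 0}" and \<mu>: "{..<\<mu>} \<lesssim> {..<a 0}"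
    and Pow_a: "\<And>k. Pow {..<a k} \<lesssim> {..<a (Suc k)}" and a_le: "\<And>k. a k \<le> \<chi>"
    and c: "c \<in> Fpow (ds_below (csucc (csucc \<chi>))) \<rightarrow> {..<\<mu>}"
begin

definition \<Theta> :: 'o where "\<Theta> = csucc (csucc \<chi>)"

definition T :: "'o list set" where "T = ds_below \<Theta>"

text \<open>
  The indices with first component \<open>k\<close> stand for the sets that are added at level \<open>k\<close>. They are kept
  at all later levels, so that one function \<open>g\<close> on indices can serve as a promise at every level.
\<close>

definition index :: "nat \<Rightarrow> (nat \<times> 'o) set" where
  "index m = {(k, \<xi>). k \<le> m \<and> \<xi> < a k}"

lemma S_closed: "\<forall>\<eta>\<in>S. \<forall>\<nu>. prefix \<nu> \<eta> \<longrightarrow> \<nu> \<in> S"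
  using S by (simp add: tree_def)

lemma a_lepoll_Suc: "{..<a k} \<lesssim> {..<a (Suc k)}"
  by (rule lepoll_trans[OF lepoll_Pow_self Pow_a])

lemma a_mono: "k \<le> m \<Longrightarrow> {..<a k} \<lesssim> {..<a m}"
  by (induction rule: dec_induct) (use a_lepoll_Suc lepoll_trans in \<open>blast+\<close>)

lemma infinite_lessThan_a: "infinite {..<a m}"
  using a_mono[of 0 m] infinite_a lepoll_trans unfolding infinite_le_lepoll by blast

lemma a_lepoll_\<chi>: "{..<a k} \<lesssim> {..<\<chi>}"
  by (rule lessThan_lepoll_mono[OF a_le])

lemma infinite_\<chi>: "infinite {..<\<chi>}"
  using a_lepoll_\<chi>[of 0] infinite_a lepoll_trans unfolding infinite_le_lepoll by blast

lemma \<chi>_lepoll_csucc: "{..<\<chi>} \<lesssim> {..<csucc \<chi>}"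
  by (rule lesspoll_imp_lepoll[OF lesspoll_csucc])

lemma infinite_csucc_\<chi>: "infinite {..<csucc \<chi>}"
  using \<chi>_lepoll_csucc infinite_\<chi> lepoll_trans unfolding infinite_le_lepoll by blast

lemma index_lepoll: "index m \<lesssim> {..<a m}"
proof -
  have "index m = (\<Union>k\<in>{..m}. Pair k ` {..<a k})" by (auto simp: index_def)
  also have "\<dots> \<lesssim> {..<a m}"
    by (intro UN_lepoll infinite_lessThan_a finite_lepoll_infinite
        lepoll_trans[OF image_lepoll a_mono]) auto
  finally show ?thesis .
qed

lemma Pow_S_lepoll: "Pow S \<lesssim> {..<a m}" and S_lepoll: "S \<lesssim> {..<a m}"
  and \<mu>_lepoll: "{..<\<mu>} \<lesssim> {..<a m}"
proof -
  show P: "Pow S \<lesssim> {..<a m}" by (rule lepoll_trans[OF Pow_S a_mono]) simp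
  show "S \<lesssim> {..<a m}" by (rule lepoll_trans[OF lepoll_Pow_self P])
  show "{..<\<mu>} \<lesssim> {..<a m}" by (rule lepoll_trans[OF \<mu> a_mono]) simp
qed

definition config :: "nat \<Rightarrow> 'o list \<Rightarrow> (nat \<times> 'o \<Rightarrow> 'o list set) \<Rightarrow> bool" where
  "config m \<tau> B \<longleftrightarrow> \<tau> \<in> T \<and> length \<tau> = m \<and> (\<forall>\<iota>\<in>index m. B \<iota> \<in> Fpow T)"

definition copyable ::
    "nat \<Rightarrow> 'o list \<Rightarrow> (nat \<times> 'o \<Rightarrow> 'o list set) \<Rightarrow> (nat \<times> 'o \<Rightarrow> nat \<Rightarrow> 'o) \<Rightarrow> 'o list \<Rightarrow> bool" where
  "copyable m \<tau> B g \<sigma> \<longleftrightarrow> (\<exists>f. good_copy c S T (index m) B g \<sigma> \<tau> f)"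

text \<open>
  The conclusion of \<open>copies_extend\<close> in terms of indices: at the two nodes, the promise is the same
  function \<open>g\<close>.
\<close>

definition linked :: "nat \<Rightarrow> 'o list \<Rightarrow> (nat \<times> 'o \<Rightarrow> 'o list set) \<Rightarrow>
    'o list \<Rightarrow> (nat \<times> 'o \<Rightarrow> 'o list set) \<Rightarrow> bool" where
  "linked m \<tau> B \<tau>' B' \<longleftrightarrow> (\<forall>\<sigma>\<in>S. \<forall>g. length \<sigma> = m \<longrightarrow> (\<forall>\<iota> l. g \<iota> l < \<mu>) \<longrightarrow>
     (\<forall>\<iota>\<in>index m. c (insert \<tau> (B \<iota>)) = g \<iota> m) \<longrightarrow>
     (\<forall>\<alpha>. \<sigma> @ [\<alpha>] \<in> S \<longrightarrow> copyable (Suc m) \<tau>' B' g (\<sigma> @ [\<alpha>])) \<longrightarrow> copyable m \<tau> B g \<sigma>)"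

text \<open>
  The type records the colours of the node together with each of its sets, and for every \<open>\<sigma>\<close> the
  promises that can be kept, where a promise is represented by its graph on the indices of the level. Whether a
  configuration is linked to a given one depends only on its type (\<open>linked_transfer\<close>), and there are few types (\<open>config_type_lepoll\<close>).
\<close>

definition config_type where
  "config_type m \<tau> B =
     ({(\<iota>, c (insert \<tau> (B \<iota>))) | \<iota>. \<iota> \<in> index m},
      {(\<sigma>, {(\<iota>, l, g \<iota> l) | \<iota> l. \<iota> \<in> index m}) | \<sigma> g.
         \<sigma> \<in> S \<and> (\<forall>\<iota> l. g \<iota> l < \<mu>) \<and> copyable m \<tau> B g \<sigma>})"

text \<open>The ordinals below \<open>height \<tau>\<close> are those by which \<open>\<tau>\<close> can be continued in \<open>T\<close>.\<close>

definition height :: "'o list \<Rightarrow> 'o" where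
  "height \<tau> = (if \<tau> = [] then \<Theta> else last \<tau>)"

text \<open>
  This is a property of the type of a configuration. A single node cannot be continued
  through infinitely many levels, but a type that is realised at nodes of arbitrary height can.
\<close>

definition big :: "nat \<Rightarrow> 'o list \<Rightarrow> (nat \<times> 'o \<Rightarrow> 'o list set) \<Rightarrow> bool" where
  "big m \<tau> B \<longleftrightarrow> config m \<tau> B \<and> (\<forall>\<beta><\<Theta>. \<exists>\<tau>' B'. config m \<tau>' B' \<and>
     config_type m \<tau>' B' = config_type m \<tau> B \<and> \<beta> \<le> height \<tau>')"

lemma config_type_colour:
  assumes "config_type m \<tau> B = config_type m \<tau>' B'" "\<iota> \<in> index m"
  shows "c (insert \<tau> (B \<iota>)) = c (insert \<tau>' (B' \<iota>))"
proof -
  have "(\<iota>, c (insert \<tau> (B \<iota>))) \<in> fst (config_type m \<tau>' B')"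
    unfolding assms(1)[symmetric] unfolding config_type_def fst_conv using assms(2) by blast
  then show ?thesis unfolding config_type_def fst_conv by fast
qed

lemma config_type_copyable:
  assumes "config_type m \<tau> B = config_type m \<tau>' B'" "\<sigma> \<in> S" "\<And>\<iota> l. g \<iota> l < \<mu>"
    and "copyable m \<tau> B g \<sigma>"
  shows "copyable m \<tau>' B' g \<sigma>"
proof -
  have "(\<sigma>, {(\<iota>, l, g \<iota> l) | \<iota> l. \<iota> \<in> index m}) \<in> snd (config_type m \<tau>' B')"
    unfolding assms(1)[symmetric] unfolding config_type_def snd_conv using assms(2-4) by blast
  then obtain g' where g': "copyable m \<tau>' B' g' \<sigma>"
    and eq: "{(\<iota>, l, g \<iota> l) | \<iota> l. \<iota> \<in> index m} = {(\<iota>, l, g' \<iota> l) | \<iota> l. \<iota> \<in> index m}"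
    unfolding config_type_def snd_conv by (elim CollectE exE conjE Pair_inject) (rule that, simp_all)
  have "g \<iota> = g' \<iota>" if "\<iota> \<in> index m" for \<iota>
  proof
    fix l
    have "(\<iota>, l, g \<iota> l) \<in> {(\<iota>, l, g' \<iota> l) | \<iota> l. \<iota> \<in> index m}"
      unfolding eq[symmetric] using that by blast
    then show "g \<iota> l = g' \<iota> l" by blast
  qed
  moreover obtain f where f: "good_copy c S T (index m) B' g' \<sigma> \<tau>' f"
    using g' by (auto simp: copyable_def)
  ultimately show ?thesis
    unfolding copyable_def
    by (intro exI[of _ f] good_copy_reindex[OF f, where r = "\<lambda>\<iota>. \<iota>"]) auto
qed

lemma linked_transfer:
  assumes "linked m \<tau> B \<upsilon> D" and \<tau>: "config_type m \<tau> B = config_type m \<tau>' B'"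
  shows "linked m \<tau>' B' \<upsilon> D"
  unfolding linked_def
proof (intro ballI allI impI)
  fix \<sigma> g
  assume *: "\<sigma> \<in> S" "length \<sigma> = m" "\<forall>\<iota> l. g \<iota> l < \<mu>"
    "\<forall>\<iota>\<in>index m. c (insert \<tau>' (B' \<iota>)) = g \<iota> m"
    "\<forall>\<alpha>. \<sigma> @ [\<alpha>] \<in> S \<longrightarrow> copyable (Suc m) \<upsilon> D g (\<sigma> @ [\<alpha>])"
  then have "\<forall>\<iota>\<in>index m. c (insert \<tau> (B \<iota>)) = g \<iota> m"
    using config_type_colour[OF \<tau>] by simp
  then have "copyable m \<tau> B g \<sigma>"
    using assms(1) * unfolding linked_def by blast
  then show "copyable m \<tau>' B' g \<sigma>"
    using config_type_copyable[OF \<tau>] * by blast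
qed

lemma config_type_lepoll:
  "(\<lambda>(\<tau>, B). config_type m \<tau> B) ` {(\<tau>, B). config m \<tau> B} \<lesssim> {..<\<chi>}"
proof -
  let ?K = "{..<a m}"
  have K: "infinite ?K" "infinite (Pow ?K)" "infinite (Pow (Pow ?K))"
    using infinite_lessThan_a by auto
  have nat: "(UNIV :: nat set) \<lesssim> ?K" using K(1) infinite_le_lepoll by blast
  have I: "Pow (index m \<times> {..<\<mu>}) \<lesssim> Pow ?K"
    by (intro Pow_lepoll_mono Times_lepoll K index_lepoll \<mu>_lepoll)
  have "Pow (index m \<times> (UNIV :: nat set) \<times> {..<\<mu>}) \<lesssim> Pow ?K"
    by (intro Pow_lepoll_mono Times_lepoll K index_lepoll \<mu>_lepoll nat)
  then have "S \<times> Pow (index m \<times> (UNIV :: nat set) \<times> {..<\<mu>}) \<lesssim> Pow ?K"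
    by (intro Times_lepoll K lepoll_trans[OF S_lepoll lepoll_Pow_self])
  then have II: "Pow (S \<times> Pow (index m \<times> (UNIV :: nat set) \<times> {..<\<mu>})) \<lesssim> Pow (Pow ?K)"
    by (rule Pow_lepoll_mono)
  have "(\<lambda>(\<tau>, B). config_type m \<tau> B) ` {(\<tau>, B). config m \<tau> B} \<subseteq>
    Pow (index m \<times> {..<\<mu>}) \<times> Pow (S \<times> Pow (index m \<times> (UNIV :: nat set) \<times> {..<\<mu>}))"
  proof (rule image_subsetI, clarify)
    fix \<tau> B assume B: "config m \<tau> B"
    have "insert \<tau> (B \<iota>) \<in> Fpow T" if "\<iota> \<in> index m" for \<iota>
      using B that unfolding config_def Fpow_def by blast
    then have "c (insert \<tau> (B \<iota>)) < \<mu>" if "\<iota> \<in> index m" for \<iota>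
      using c that unfolding T_def \<Theta>_def by blast
    then show "config_type m \<tau> B \<in> Pow (index m \<times> {..<\<mu>}) \<times>
        Pow (S \<times> Pow (index m \<times> (UNIV :: nat set) \<times> {..<\<mu>}))"
      by (auto simp: config_type_def)
  qed
  then have "(\<lambda>(\<tau>, B). config_type m \<tau> B) ` {(\<tau>, B). config m \<tau> B} \<lesssim> Pow (Pow ?K)"
    by (rule lepoll_trans[OF subset_imp_lepoll])
      (intro Times_lepoll K II lepoll_trans[OF I lepoll_Pow_self])
  also have "\<dots> \<lesssim> Pow {..<a (Suc m)}" by (rule Pow_lepoll_mono[OF Pow_a])
  also have "\<dots> \<lesssim> {..<a (Suc (Suc m))}" by (rule Pow_a)
  also have "\<dots> \<lesssim> {..<\<chi>}" by (rule a_lepoll_\<chi>)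
  finally show ?thesis .
qed

text \<open>
  A node of sufficient height has a whole block of order type \<open>\<chi>\<^sup>+\<close> of children beyond \<open>\<beta>\<close>. In such a
  block, no set of size \<open>a (m + 1)\<close> is cofinal, so that \<open>copies_extend\<close> applies.
\<close>

lemma config_extend:
  assumes "\<beta> < \<Theta>"
  shows "\<exists>b<\<Theta>. \<forall>\<tau> B. config m \<tau> B \<and> b \<le> height \<tau> \<longrightarrow>
    (\<exists>\<tau>' B'. config (Suc m) \<tau>' B' \<and> \<beta> \<le> height \<tau>' \<and> linked m \<tau> B \<tau>' B')"
proof -
  obtain b where b: "b < \<Theta>"
    "\<forall>Y\<subseteq>{\<beta>..<b}. Y \<lesssim> {..<\<chi>} \<longrightarrow> (\<exists>x\<in>{\<beta>..<b}. \<forall>y\<in>Y. y < x)"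
    using ex_block[OF infinite_\<chi>] assms unfolding \<Theta>_def by blast
  have "\<exists>\<tau>' B'. config (Suc m) \<tau>' B' \<and> \<beta> \<le> height \<tau>' \<and> linked m \<tau> B \<tau>' B'"
    if B: "config m \<tau> B" and b_le: "b \<le> height \<tau>" for \<tau> B
  proof -
    have \<tau>: "\<tau> \<in> T" "length \<tau> = m" and BT: "\<forall>\<iota>\<in>index m. B \<iota> \<in> Fpow T"
      using B by (auto simp: config_def)
    have X: "\<forall>Y\<subseteq>{\<beta>..<b}. Y \<lesssim> {..<a (Suc m)} \<longrightarrow> (\<exists>x\<in>{\<beta>..<b}. \<forall>y\<in>Y. y < x)"
      using b(2) lepoll_trans[OF _ a_lepoll_\<chi>] by blast
    obtain x \<B> where x: "x \<in> {\<beta>..<b}" and \<B>: "\<B> \<subseteq> Fpow T" "\<B> \<lesssim> {..<a (Suc m)}"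
      and ext: "controls c S T (index m) B {..<\<mu>} \<tau> (\<tau> @ [x]) \<B>"
      using copies_extend[where c = c, OF S_closed \<tau>(1) BT infinite_lessThan_a index_lepoll
          Pow_S_lepoll \<mu>_lepoll Pow_a X] by blast
    obtain e where e: "\<B> \<subseteq> e ` {..<a (Suc m)}" using \<B>(2) unfolding lepoll_iff by blast
    \<comment> \<open>The old sets keep their indices; the new indices enumerate \<open>\<B>\<close>.\<close>
    define B' where "B' = (\<lambda>(k, \<xi>). if k \<le> m then B (k, \<xi>) else if e \<xi> \<in> \<B> then e \<xi> else {})"
    have old: "\<iota> \<in> index (Suc m)" "B' \<iota> = B \<iota>" if "\<iota> \<in> index m" for \<iota>
      using that by (auto simp: index_def B'_def)
    have new: "\<exists>\<iota>\<in>index (Suc m). B' \<iota> = d" if "d \<in> \<B>" for d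
    proof -
      obtain \<xi> where "\<xi> < a (Suc m)" "d = e \<xi>" using e \<open>d \<in> \<B>\<close> by blast
      then show ?thesis
        using that by (intro bexI[of _ "(Suc m, \<xi>)"]) (auto simp: index_def B'_def)
    qed
    have "x < height \<tau>" "x < \<Theta>" using x b_le b(1) by auto
    then have "\<tau> @ [x] \<in> T"
      using \<tau>(1) by (auto simp: T_def ds_below_def ds_append_singleton height_def)
    moreover have "B' \<iota> \<in> Fpow T" if "\<iota> \<in> index (Suc m)" for \<iota>
    proof (cases "\<iota> \<in> index m")
      case True
      then show ?thesis using old BT by simp
    next
      case False
      then have "\<not> fst \<iota> \<le> m" using that by (auto simp: index_def)
      then have "B' \<iota> \<in> \<B> \<or> B' \<iota> = {}" by (simp add: B'_def split_beta)
      then show ?thesis using \<B>(1) by (auto simp: Fpow_def)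
    qed
    ultimately have "config (Suc m) (\<tau> @ [x]) B'" using \<tau>(2) by (simp add: config_def)
    moreover have "\<beta> \<le> height (\<tau> @ [x])" using x by (simp add: height_def)
    moreover have "linked m \<tau> B (\<tau> @ [x]) B'"
      unfolding linked_def
    proof (intro ballI allI impI)
      fix \<sigma> g
      assume \<sigma>: "\<sigma> \<in> S" "length \<sigma> = m" and g: "\<forall>\<iota> l. g \<iota> l < \<mu>"
        and root: "\<forall>\<iota>\<in>index m. c (insert \<tau> (B \<iota>)) = g \<iota> m"
        and child: "\<forall>\<alpha>. \<sigma> @ [\<alpha>] \<in> S \<longrightarrow> copyable (Suc m) (\<tau> @ [x]) B' g (\<sigma> @ [\<alpha>])"
      \<comment> \<open>Turns a promise about indices into one about sets. If a set has several indices, all of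
        them carry the same colours at the levels that occur.\<close>
      define r where "r d = (SOME \<iota>. \<iota> \<in> index (Suc m) \<and> B' \<iota> = d)" for d
      have r: "r d \<in> index (Suc m)" "B' (r d) = d" if "\<exists>\<iota>\<in>index (Suc m). B' \<iota> = d" for d
        using someI_ex[of "\<lambda>\<iota>. \<iota> \<in> index (Suc m) \<and> B' \<iota> = d"] that unfolding r_def by blast+
      show "copyable m \<tau> B g \<sigma>"
        unfolding copyable_def
      proof (rule ext[unfolded controls_def, THEN bspec, THEN spec[where x = "\<lambda>d. g (r d)"],
            THEN spec, THEN mp, THEN mp, THEN mp, THEN mp, THEN mp])
        show "\<forall>\<alpha>. \<sigma> @ [\<alpha>] \<in> S \<longrightarrow>
            (\<exists>f. good_copy c S T \<B> (\<lambda>b. b) (\<lambda>d. g (r d)) (\<sigma> @ [\<alpha>]) (\<tau> @ [x]) f)"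
        proof (intro allI impI)
          fix \<alpha> assume "\<sigma> @ [\<alpha>] \<in> S"
          then obtain f where f: "good_copy c S T (index (Suc m)) B' g (\<sigma> @ [\<alpha>]) (\<tau> @ [x]) f"
            using child by (auto simp: copyable_def)
          show "\<exists>f. good_copy c S T \<B> (\<lambda>b. b) (\<lambda>d. g (r d)) (\<sigma> @ [\<alpha>]) (\<tau> @ [x]) f"
            by (intro exI[of _ f] good_copy_reindex[OF f, where r = r]) (use r[OF new] in simp)
        qed
        show "\<forall>\<iota>\<in>index m. \<forall>\<rho>\<in>cone S \<sigma>. \<rho> \<noteq> \<sigma> \<longrightarrow> g (r (B \<iota>)) (length \<rho>) = g \<iota> (length \<rho>)"
        proof (intro ballI impI)
          fix \<iota> \<rho> assume \<iota>: "\<iota> \<in> index m" and \<rho>: "\<rho> \<in> cone S \<sigma>" "\<rho> \<noteq> \<sigma>"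
          obtain \<alpha> where \<alpha>: "\<sigma> @ [\<alpha>] \<in> S" "\<rho> \<in> cone S (\<sigma> @ [\<alpha>])"
            using cone_cases[OF \<rho>(1) S_closed] \<rho>(2) by metis
          then obtain f where f: "good_copy c S T (index (Suc m)) B' g (\<sigma> @ [\<alpha>]) (\<tau> @ [x]) f"
            using child by (auto simp: copyable_def)
          have "c (insert (f \<rho>) (B' \<iota>')) = g \<iota>' (length \<rho>)" if "\<iota>' \<in> index (Suc m)" for \<iota>'
            using f \<alpha>(2) that unfolding good_copy_def by blast
          moreover have "r (B \<iota>) \<in> index (Suc m)" "B' (r (B \<iota>)) = B \<iota>"
            using r[of "B \<iota>"] old[OF \<iota>] by blast+
          ultimately show "g (r (B \<iota>)) (length \<rho>) = g \<iota> (length \<rho>)"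
            using old[OF \<iota>] by (metis (no_types))
        qed
      qed (use \<sigma> g root \<tau>(2) in \<open>simp_all only: lessThan_iff, simp_all\<close>)
    qed
    ultimately show ?thesis by blast
  qed
  with b(1) show ?thesis by blast
qed

text \<open>
  For every \<open>\<beta>\<close> there is a linked configuration of height at least \<open>\<beta>\<close> on the next level.
  There are more \<open>\<beta>\<close> than types, so one type occurs for cofinally many of them.
\<close>

lemma big_extend:
  assumes "big m \<tau> B"
  shows "\<exists>\<tau>' B'. big (Suc m) \<tau>' B' \<and> linked m \<tau> B \<tau>' B'"
proof -
  have "\<exists>p. config (Suc m) (fst p) (snd p) \<and> \<beta> \<le> height (fst p) \<and>
      linked m \<tau> B (fst p) (snd p)" if \<beta>: "\<beta> < \<Theta>" for \<beta>
  proof -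
    obtain b where b: "b < \<Theta>" "\<And>\<tau> B. config m \<tau> B \<Longrightarrow> b \<le> height \<tau> \<Longrightarrow>
      \<exists>\<tau>' B'. config (Suc m) \<tau>' B' \<and> \<beta> \<le> height \<tau>' \<and> linked m \<tau> B \<tau>' B'"
      using config_extend[OF \<beta>, of m] by blast
    obtain \<tau>1 B1 where 1: "config m \<tau>1 B1" "config_type m \<tau>1 B1 = config_type m \<tau> B"
      "b \<le> height \<tau>1"
      using assms b(1) unfolding big_def by blast
    then obtain \<tau>' B' where "config (Suc m) \<tau>' B'" "\<beta> \<le> height \<tau>'" "linked m \<tau>1 B1 \<tau>' B'"
      using b(2) by blast
    then show ?thesis
      using linked_transfer[OF _ 1(2)] by (intro exI[of _ "(\<tau>', B')"]) auto
  qed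
  then obtain E where E: "\<And>\<beta>. \<beta> < \<Theta> \<Longrightarrow> config (Suc m) (fst (E \<beta>)) (snd (E \<beta>)) \<and>
      \<beta> \<le> height (fst (E \<beta>)) \<and> linked m \<tau> B (fst (E \<beta>)) (snd (E \<beta>))"
    by metis
  define h where "h \<beta> = config_type (Suc m) (fst (E \<beta>)) (snd (E \<beta>))" for \<beta>
  have "h ` {..<csucc (csucc \<chi>)} \<subseteq>
      (\<lambda>(\<tau>, B). config_type (Suc m) \<tau> B) ` {(\<tau>, B). config (Suc m) \<tau> B}"
  proof (rule image_subsetI)
    fix \<beta> assume "\<beta> \<in> {..<csucc (csucc \<chi>)}"
    then have "E \<beta> \<in> {(\<tau>, B). config (Suc m) \<tau> B}"
      using E unfolding \<Theta>_def by (simp add: split_beta)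
    then show "h \<beta> \<in> (\<lambda>(\<tau>, B). config_type (Suc m) \<tau> B) ` {(\<tau>, B). config (Suc m) \<tau> B}"
      unfolding h_def by (intro image_eqI[of _ _ "E \<beta>"]) (simp_all add: split_beta)
  qed
  then have "h ` {..<csucc (csucc \<chi>)} \<lesssim> {..<csucc \<chi>}"
    by (rule lepoll_trans[OF lepoll_trans[OF subset_imp_lepoll config_type_lepoll]
          \<chi>_lepoll_csucc])
  then obtain \<alpha> where \<alpha>: "\<alpha> < \<Theta>" "\<And>\<beta>. \<beta> < \<Theta> \<Longrightarrow> \<exists>\<gamma>\<ge>\<beta>. \<gamma> < \<Theta> \<and> h \<gamma> = h \<alpha>"
    using csucc_pigeonhole[OF infinite_csucc_\<chi>, of h] unfolding \<Theta>_def by blast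
  have "\<exists>\<tau>' B'. config (Suc m) \<tau>' B' \<and>
     config_type (Suc m) \<tau>' B' = config_type (Suc m) (fst (E \<alpha>)) (snd (E \<alpha>)) \<and> \<beta> \<le> height \<tau>'"
    if \<beta>: "\<beta> < \<Theta>" for \<beta>
  proof -
    obtain \<gamma> where \<gamma>: "\<beta> \<le> \<gamma>" "\<gamma> < \<Theta>" "h \<gamma> = h \<alpha>" using \<alpha>(2)[OF \<beta>] by blast
    then show ?thesis
      using E[OF \<gamma>(2)] unfolding h_def
      by (intro exI[of _ "fst (E \<gamma>)"] exI[of _ "snd (E \<gamma>)"]) (auto intro: order_trans)
  qed
  then have "big (Suc m) (fst (E \<alpha>)) (snd (E \<alpha>))"
    using E[OF \<alpha>(1)] unfolding big_def by blast
  then show ?thesis using E[OF \<alpha>(1)] by blast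
qed

text \<open>
  The nodes \<open>fst (p m)\<close> of a linked sequence of big configurations do not form a branch of \<open>T\<close>. Still
  they determine a promise: at level \<open>l\<close>, the colour is the one of the node number \<open>l\<close>. With this choice the premise
  about colours in \<open>linked\<close> holds at all levels, and induction from the leaves of \<open>S\<close> applies.
\<close>

lemma ex_tail_uniform_copy:
  "\<exists>f. lx2_embedding f S \<and> f ` S \<subseteq> T \<and> tail_uniform c {} f S \<and>
    (\<forall>\<rho>\<in>S. \<forall>\<rho>'\<in>S. length \<rho> = length \<rho>' \<longrightarrow> c {f \<rho>} = c {f \<rho>'})"
proof -
  define start :: "'o list \<times> (nat \<times> 'o \<Rightarrow> 'o list set)" where "start = ([], \<lambda>_. {})"
  have nil: "[] \<in> T" by (simp add: T_def ds_below_def ds_def)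
  then have "big 0 (fst start) (snd start)"
    unfolding big_def config_def start_def height_def
    by (auto simp: Fpow_def intro!: exI[of _ "\<lambda>_. {}"] exI[of _ "[]"] less_imp_le)
  then have "\<exists>p. \<forall>m. (big m (fst (p m)) (snd (p m)) \<and> (m = 0 \<longrightarrow> p m = start)) \<and>
      linked m (fst (p m)) (snd (p m)) (fst (p (Suc m))) (snd (p (Suc m)))"
  proof (intro dependent_nat_choice)
    fix m and q :: "'o list \<times> (nat \<times> 'o \<Rightarrow> 'o list set)"
    assume "big m (fst q) (snd q) \<and> (m = 0 \<longrightarrow> q = start)"
    then obtain \<tau>' B' where "big (Suc m) \<tau>' B'" "linked m (fst q) (snd q) \<tau>' B'"
      using big_extend by blast
    then show "\<exists>y. (big (Suc m) (fst y) (snd y) \<and> (Suc m = 0 \<longrightarrow> y = start)) \<and>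
        linked m (fst q) (snd q) (fst y) (snd y)"
      by (intro exI[of _ "(\<tau>', B')"]) simp
  qed blast
  then obtain p where p: "\<And>m. big m (fst (p m)) (snd (p m))" "p 0 = start"
    "\<And>m. linked m (fst (p m)) (snd (p m)) (fst (p (Suc m))) (snd (p (Suc m)))"
    by metis
  \<comment> \<open>The value \<open>c {}\<close> only serves as some colour below \<open>\<mu>\<close>.\<close>
  define g where "g \<iota> l = (if \<iota> \<in> index l then c (insert (fst (p l)) (snd (p l) \<iota>)) else c {})"
    for \<iota> l
  have g: "g \<iota> l < \<mu>" for \<iota> l
  proof -
    have "insert (fst (p l)) (snd (p l) \<iota>) \<in> Fpow T" if "\<iota> \<in> index l"
      using p(1)[of l] that unfolding big_def config_def Fpow_def by blast
    moreover have "{} \<in> Fpow T" by (simp add: Fpow_def)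
    ultimately show ?thesis using c unfolding g_def T_def \<Theta>_def by auto
  qed
  have copyable: "copyable (length \<sigma>) (fst (p (length \<sigma>))) (snd (p (length \<sigma>))) g \<sigma>" if "\<sigma> \<in> S" for \<sigma>
  proof (rule ds_children_induct[OF that])
    show "S \<subseteq> ds" using S by (simp add: tree_def)
    fix \<sigma> assume \<sigma>: "\<sigma> \<in> S"
      and IH: "\<And>\<alpha>. \<sigma> @ [\<alpha>] \<in> S \<Longrightarrow> copyable (length (\<sigma> @ [\<alpha>])) (fst (p (length (\<sigma> @ [\<alpha>]))))
         (snd (p (length (\<sigma> @ [\<alpha>])))) g (\<sigma> @ [\<alpha>])"
    show "copyable (length \<sigma>) (fst (p (length \<sigma>))) (snd (p (length \<sigma>))) g \<sigma>"
      by (rule p(3)[of "length \<sigma>", unfolded linked_def, rule_format, OF \<sigma>])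
        (use g IH in \<open>auto simp: g_def\<close>)
  qed
  have "[] \<in> S" using S by (auto simp: tree_def)
  then have "copyable 0 [] (\<lambda>_. {}) g []" using copyable[of "[]"] p(2) by (simp add: start_def)
  then obtain f where f: "good_copy c S T (index 0) (\<lambda>_. {}) g [] [] f"
    by (auto simp: copyable_def)
  have "{..<a 0} \<noteq> {}" using infinite_a by force
  then obtain \<xi> where "(0, \<xi>) \<in> index 0" by (auto simp: index_def)
  moreover have "cone S [] = S" by (simp add: cone_def)
  ultimately have "lx2_embedding f S \<and> f ` S \<subseteq> T \<and> tail_uniform c {} f S \<and>
    (\<forall>\<rho>\<in>S. c {f \<rho>} = g (0, \<xi>) (length \<rho>))"
    using f unfolding good_copy_def by metis
  then show ?thesis by metis
qed

end


section \<open>From one end element to \<open>n\<close>\<close>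

lemma sorted_wrt_lx2_map:
  assumes "lx2_embedding h A" "set \<eta>s \<subseteq> A"
  shows "sorted_wrt lx2 (map h \<eta>s) \<longleftrightarrow> sorted_wrt lx2 \<eta>s"
  using assms(2) by (induction \<eta>s) (auto simp: lx2_embeddingD(3)[OF assms(1)] subset_iff)

lemma similar_map:
  assumes "lx2_embedding h A" "set \<eta>s \<subseteq> A" "set \<nu>s \<subseteq> A"
  shows "similar (map h \<eta>s) (map h \<nu>s) \<longleftrightarrow> similar \<eta>s \<nu>s"
proof (cases "length \<eta>s = length \<nu>s")
  case True
  have "\<eta>s ! i \<in> A" "\<nu>s ! i \<in> A" if "i < length \<nu>s" for i
    using assms(2,3) that True nth_mem by (metis subsetD)+
  moreover have "length (h \<eta>) = length \<eta>" if "\<eta> \<in> A" for \<eta>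
    using lx2_embeddingD(1)[OF assms(1) that that] .
  ultimately show ?thesis
    unfolding similar_def using True lx2_embeddingD(2,3)[OF assms(1)] by simp
qed (simp add: similar_def)

lemma similar_appendD:
  assumes "similar (\<eta>s @ \<rho>s) (\<nu>s @ \<rho>s')" "length \<eta>s = length \<nu>s"
  shows "similar \<eta>s \<nu>s"
proof -
  have "length (\<eta>s @ \<rho>s) = length (\<nu>s @ \<rho>s')" using assms(1) by (simp add: similar_def)
  have "length (\<eta>s ! i) = length (\<nu>s ! i) \<and>
      lcp_length (\<eta>s ! i) (\<eta>s ! j) = lcp_length (\<nu>s ! i) (\<nu>s ! j) \<and>
      (lx2 (\<eta>s ! i) (\<eta>s ! j) \<longleftrightarrow> lx2 (\<nu>s ! i) (\<nu>s ! j))"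
    if "i < length \<eta>s" "j < length \<eta>s" for i j
    using assms(1)[unfolded similar_def, THEN conjunct2, rule_format, of i j] that assms(2)
    by (simp add: nth_append)
  then show ?thesis using assms(2) by (simp add: similar_def)
qed

lemma similar_last:
  assumes "similar (\<eta>s @ [\<rho>]) (\<nu>s @ [\<rho>'])"
  shows "length \<rho> = length \<rho>'"
    "\<eta>s \<noteq> [] \<Longrightarrow> lcp_length (last \<eta>s) \<rho> = lcp_length (last \<nu>s) \<rho>'"
proof -
  have len: "length \<eta>s = length \<nu>s" using assms by (simp add: similar_def)
  note sim = assms[unfolded similar_def, THEN conjunct2, rule_format]
  show "length \<rho> = length \<rho>'"
    using sim[of "length \<eta>s" "length \<eta>s"] len by (simp add: nth_append)
  show "lcp_length (last \<eta>s) \<rho> = lcp_length (last \<nu>s) \<rho>'" if "\<eta>s \<noteq> []"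
  proof -
    have "\<nu>s \<noteq> []" using that len by auto
    then show ?thesis
      using sim[of "length \<eta>s - 1" "length \<eta>s"] len that
      by (simp add: nth_append last_conv_nth)
  qed
qed

text \<open>
  The position of \<open>\<rho>\<close> after \<open>u\<close>, up to similarity, is given by its length \<open>m\<close> and its branching level \<open>l\<close>
  with respect to the last element of \<open>u\<close>. If \<open>u\<close> is empty, there is no condition on \<open>l\<close>.
\<close>

definition extends_by ::
    "'o::ordinals list set \<Rightarrow> 'o list set \<Rightarrow> nat \<times> nat \<Rightarrow> 'o list \<Rightarrow> bool" where
  "extends_by T u = (\<lambda>(l, m) \<rho>. \<rho> \<in> T \<and> length \<rho> = m \<and>
     (\<forall>\<eta>\<in>u. lx2 \<eta> \<rho> \<and> ((\<forall>\<nu>\<in>u. \<nu> = \<eta> \<or> lx2 \<nu> \<eta>) \<longrightarrow> lcp_length \<eta> \<rho> = l)))"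

text \<open>The value \<open>c {}\<close> stands for a position that no node of \<open>T\<close> has.\<close>

definition extension_colours ::
    "('o::ordinals list set \<Rightarrow> 'c) \<Rightarrow> ('o list \<Rightarrow> 'o list) \<Rightarrow> 'o list set \<Rightarrow> 'o list set \<Rightarrow> nat \<times> nat \<Rightarrow> 'c"
  where
  "extension_colours c h T u p =
     (if \<exists>\<rho>. extends_by T u p \<rho> then c (h ` insert (SOME \<rho>. extends_by T u p \<rho>) u) else c {})"

text \<open>
  Split off the last element of each of the two sequences. By tail-uniformity, the colour of a sequence
  under \<open>c\<close> is the value of \<open>extension_colours\<close> for the remaining elements, at the position of the last
  one. The remaining elements have the same \<open>extension_colours\<close> by assumption, and similarity makes the positions equal.
\<close>

lemma end_uniform_Suc:
  assumes h: "lx2_embedding h T" "tail_uniform c {} h T"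
    and level: "\<forall>\<rho>\<in>T. \<forall>\<rho>'\<in>T. length \<rho> = length \<rho>' \<longrightarrow> c {h \<rho>} = c {h \<rho>'}"
    and A: "A \<subseteq> T" "end_uniform n (extension_colours c h T) A"
  shows "end_uniform (Suc n) c (h ` A)"
proof -
  have colour: "c (h ` insert \<rho> u) = extension_colours c h T u p"
    if u: "finite u" "u \<subseteq> T" and \<rho>: "extends_by T u p \<rho>" for u p \<rho>
  proof -
    define \<rho>' where "\<rho>' = (SOME \<rho>. extends_by T u p \<rho>)"
    have \<rho>': "extends_by T u p \<rho>'" unfolding \<rho>'_def using \<rho> by (rule someI)
    have "c (insert (h \<rho>) ({} \<union> h ` u)) = c (insert (h \<rho>') ({} \<union> h ` u))"
    proof (cases "u = {}")
      case True
      then show ?thesis using level \<rho> \<rho>' by (cases p) (simp add: extends_by_def)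
    next
      case False
      then obtain \<eta> where \<eta>: "\<eta> \<in> u" "\<forall>\<nu>\<in>u. \<nu> = \<eta> \<or> lx2 \<nu> \<eta>"
        using ex_lx2_max[OF u(1)] by blast
      show ?thesis
        by (rule tail_uniformD[OF h(2) u \<eta>(1)])
          (use \<eta> \<rho> \<rho>' in \<open>cases p, auto simp: extends_by_def\<close>)
    qed
    then show ?thesis using \<rho> unfolding extension_colours_def \<rho>'_def by auto
  qed
  have pull: "\<exists>\<eta>s. \<eta>s' = map h \<eta>s \<and> set \<eta>s \<subseteq> A" if "set \<eta>s' \<subseteq> h ` A" for \<eta>s'
    using that
  proof (induction \<eta>s')
    case (Cons \<eta> \<eta>s')
    then obtain \<eta>s \<nu> where "\<eta>s' = map h \<eta>s" "set \<eta>s \<subseteq> A" "\<eta> = h \<nu>" "\<nu> \<in> A" by auto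
    then show ?case by (intro exI[of _ "\<nu> # \<eta>s"]) simp
  qed simp
  show ?thesis
    unfolding end_uniform_def
  proof (intro allI impI, elim conjE)
    fix \<eta>s' \<rho>s' \<rho>s''
    assume sub: "set \<eta>s' \<subseteq> h ` A" "set \<rho>s' \<subseteq> h ` A" "set \<rho>s'' \<subseteq> h ` A"
      and len': "length \<rho>s' = Suc n" "length \<rho>s'' = Suc n"
      and sorted': "sorted_wrt lx2 (\<eta>s' @ \<rho>s')" "sorted_wrt lx2 (\<eta>s' @ \<rho>s'')"
      and similar': "similar (\<eta>s' @ \<rho>s') (\<eta>s' @ \<rho>s'')"
    obtain \<eta>s \<pi>s \<pi>s' where \<eta>s: "\<eta>s' = map h \<eta>s" "set \<eta>s \<subseteq> A"
      and \<pi>s: "\<rho>s' = map h \<pi>s" "set \<pi>s \<subseteq> A" and \<pi>s': "\<rho>s'' = map h \<pi>s'" "set \<pi>s' \<subseteq> A"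
      using pull[OF sub(1)] pull[OF sub(2)] pull[OF sub(3)] by metis
    obtain \<rho>s \<rho> where \<rho>s: "\<pi>s = \<rho>s @ [\<rho>]" "length \<rho>s = n"
      using len'(1) \<pi>s(1) by (cases \<pi>s rule: rev_cases) auto
    obtain \<sigma>s \<sigma> where \<sigma>s: "\<pi>s' = \<sigma>s @ [\<sigma>]" "length \<sigma>s = n"
      using len'(2) \<pi>s'(1) by (cases \<pi>s' rule: rev_cases) auto
    have in_T: "set ((\<eta>s @ \<rho>s) @ [\<rho>]) \<subseteq> T" "set ((\<eta>s @ \<sigma>s) @ [\<sigma>]) \<subseteq> T"
      using \<eta>s(2) \<pi>s(2) \<pi>s'(2) \<rho>s(1) \<sigma>s(1) A(1) by auto
    have sorted: "sorted_wrt lx2 ((\<eta>s @ \<rho>s) @ [\<rho>])" "sorted_wrt lx2 ((\<eta>s @ \<sigma>s) @ [\<sigma>])"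
      using sorted' sorted_wrt_lx2_map[OF h(1) in_T(1)] sorted_wrt_lx2_map[OF h(1) in_T(2)]
      by (simp_all add: \<eta>s(1) \<pi>s(1) \<pi>s'(1) \<rho>s(1) \<sigma>s(1))
    have similar: "similar ((\<eta>s @ \<rho>s) @ [\<rho>]) ((\<eta>s @ \<sigma>s) @ [\<sigma>])"
      using similar' similar_map[OF h(1) in_T]
      by (simp add: \<eta>s(1) \<pi>s(1) \<pi>s'(1) \<rho>s(1) \<sigma>s(1))
    have "extension_colours c h T (set (\<eta>s @ \<rho>s)) = extension_colours c h T (set (\<eta>s @ \<sigma>s))"
    proof (rule A(2)[unfolded end_uniform_def, rule_format], intro conjI)
      show "similar (\<eta>s @ \<rho>s) (\<eta>s @ \<sigma>s)"
        by (rule similar_appendD[OF similar]) (simp add: \<rho>s(2) \<sigma>s(2))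
      show "sorted_wrt lx2 (\<eta>s @ \<rho>s)" "sorted_wrt lx2 (\<eta>s @ \<sigma>s)"
        using sorted by (auto simp: sorted_wrt_append)
    qed (use \<eta>s(2) \<pi>s(2) \<pi>s'(2) \<rho>s \<sigma>s in auto)
    moreover define p where
      "p = (if \<eta>s @ \<rho>s = [] then 0 else lcp_length (last (\<eta>s @ \<rho>s)) \<rho>, length \<rho>)"
    have extends: "extends_by T (set \<nu>s) (if \<nu>s = [] then 0 else lcp_length (last \<nu>s) \<rho>, length \<rho>) \<rho>"
      if "sorted_wrt lx2 (\<nu>s @ [\<rho>])" "\<rho> \<in> T" for \<nu>s \<rho>
    proof -
      have "\<eta> = last \<nu>s" if \<eta>: "\<eta> \<in> set \<nu>s" "\<forall>\<nu>\<in>set \<nu>s. \<nu> = \<eta> \<or> lx2 \<nu> \<eta>" for \<eta>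
      proof (cases \<nu>s rule: rev_cases)
        case (snoc \<nu>s' \<nu>)
        show ?thesis
        proof (rule ccontr)
          assume "\<eta> \<noteq> last \<nu>s"
          then have "lx2 \<eta> \<nu>" "lx2 \<nu> \<eta>"
            using \<eta> \<open>sorted_wrt lx2 (\<nu>s @ [\<rho>])\<close> snoc by (auto simp: sorted_wrt_append)
          then show False using lx2_trans[of \<eta> \<nu> \<eta>] by simp
        qed
      qed (use \<eta>(1) in simp)
      then show ?thesis
        using that by (auto simp: extends_by_def sorted_wrt_append)
    qed
    have "extends_by T (set (\<eta>s @ \<rho>s)) p \<rho>"
      unfolding p_def by (rule extends[OF sorted(1)]) (use in_T(1) in simp)
    moreover have "p = (if \<eta>s @ \<sigma>s = [] then 0 else lcp_length (last (\<eta>s @ \<sigma>s)) \<sigma>, length \<sigma>)"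
      using similar_last[OF similar] \<rho>s(2) \<sigma>s(2) unfolding p_def by auto
    then have "extends_by T (set (\<eta>s @ \<sigma>s)) p \<sigma>"
      using extends[OF sorted(2)] in_T(2) by auto
    moreover have "set (\<eta>s @ \<rho>s) \<subseteq> T" "set (\<eta>s @ \<sigma>s) \<subseteq> T" using in_T by auto
    ultimately have "c (h ` insert \<rho> (set (\<eta>s @ \<rho>s))) = c (h ` insert \<sigma> (set (\<eta>s @ \<sigma>s)))"
      using colour[of "set (\<eta>s @ \<rho>s)" p \<rho>] colour[of "set (\<eta>s @ \<sigma>s)" p \<sigma>] by simp
    moreover have "set (\<eta>s' @ \<rho>s') = h ` insert \<rho> (set (\<eta>s @ \<rho>s))"
      "set (\<eta>s' @ \<rho>s'') = h ` insert \<sigma> (set (\<eta>s @ \<sigma>s))"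
      using \<eta>s(1) \<pi>s(1) \<pi>s'(1) \<rho>s(1) \<sigma>s(1) by auto
    ultimately show "c (set (\<eta>s' @ \<rho>s')) = c (set (\<eta>s' @ \<rho>s''))" by simp
  qed
qed

text \<open>
  The bound on the size survives the iteration because \<open>M\<close> and the tree \<open>T0\<close> of the
  previous stage are at most \<open>2\<^bsup>\<theta>' + \<mu>\<^esup>\<close> for \<open>\<theta>' = \<beth>\<^bsub>1,n\<^esub>(\<theta>, \<mu>)\<close>, so that the new tree needs only
  a few more than \<open>\<omega>\<close> of the \<open>\<theta>'\<^sup>+\<close> available powers.
\<close>

lemma ex_end_uniform_tree:
  fixes S :: "'o::ordinals list set" and \<mu> \<theta> :: 'o
  assumes S: "tree S" "S \<lesssim> {..<\<theta>}" and \<theta>: "infinite {..<\<theta>}"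
  defines "M \<equiv> cpow2 (cadd \<mu> aleph0)"
  shows "\<exists>T. tree T \<and> (n > 0 \<longrightarrow> ocard T < beth1 n \<theta> \<mu>) \<and> T \<lesssim> {..<beth1 n \<theta> \<mu>} \<and>
    (\<forall>c\<in>Fpow T \<rightarrow> {..<M}. \<exists>f. lx2_embedding f S \<and> f ` S \<subseteq> T \<and> end_uniform n c (f ` S))"
proof (induction n)
  case 0
  have "end_uniform 0 c S" for c :: "'o list set \<Rightarrow> 'o" by (auto simp: end_uniform_def)
  then show ?case
    using S by (intro exI[of _ S]) (auto intro!: exI[of _ "\<lambda>\<eta>. \<eta>"] lx2_embedding_id)
next
  case (Suc n)
  define \<theta>' where "\<theta>' = beth1 n \<theta> \<mu>"
  obtain T0 where T0: "tree T0" "T0 \<lesssim> {..<\<theta>'}"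
    and IH: "\<And>c. c \<in> Fpow T0 \<rightarrow> {..<M} \<Longrightarrow>
      \<exists>f. lx2_embedding f S \<and> f ` S \<subseteq> T0 \<and> end_uniform n c (f ` S)"
    using Suc.IH unfolding \<theta>'_def by blast
  have \<theta>': "infinite {..<\<theta>'}"
    unfolding \<theta>'_def by (rule infinite_lessThan_beth1[OF \<theta>])
  define \<psi> where "\<psi> = cadd \<theta>' \<mu>"
  have \<psi>: "{..<\<theta>'} \<lesssim> {..<\<psi>}" "{..<\<mu>} \<lesssim> {..<\<psi>}" unfolding \<psi>_def by (rule lepoll_cadd)+
  obtain a \<chi> where a: "a 0 = \<psi>" "\<And>k::nat. a (Suc k) = cpow2 (a k)" "\<And>k. a k \<le> \<chi>"
    and \<chi>: "\<And>j. (cpow2 ^^ j) \<chi> < beth (csucc \<theta>') \<psi>"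
    using ex_power_sequence[OF \<theta>', of \<psi>] by blast
  have \<psi>_inf: "infinite {..<\<psi>}"
    using \<theta>' \<psi>(1) lepoll_trans unfolding infinite_le_lepoll by blast
  have a1: "a (Suc 0) = cpow2 \<psi>" using a(1,2) by simp
  have Pow_\<psi>: "Pow A \<lesssim> {..<a (Suc 0)}" if "A \<lesssim> {..<\<psi>}" for A :: "'b set"
    unfolding a1 by (rule lepoll_trans2[OF Pow_lepoll_mono[OF that] eqpoll_cpow2])
  have aleph0: "{..<aleph0::'o} \<lesssim> {..<\<theta>'}"
  proof -
    have "(UNIV :: nat set) \<lesssim> {..<\<theta>'}" using \<theta>' infinite_le_lepoll by blast
    then show ?thesis
      unfolding aleph0_def using eqpoll_ocard(1) eqpoll_sym lepoll_trans1 by blast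
  qed
  have inf_\<nu>: "infinite {..<cadd \<mu> aleph0}"
    using infinite_lessThan_aleph0 lepoll_cadd(2) lepoll_trans unfolding infinite_le_lepoll by blast
  have "{..<cadd \<mu> aleph0} \<lesssim> {..<\<mu>} <+> {..<aleph0::'o}"
    by (rule eqpoll_imp_lepoll[OF eqpoll_cadd])
  also have "\<dots> \<lesssim> {..<\<psi>}"
    unfolding Plus_def
    by (intro Un_lepoll[OF \<psi>_inf] lepoll_trans[OF image_lepoll] \<psi>(2) lepoll_trans[OF aleph0 \<psi>(1)])
  finally have "Pow {..<cadd \<mu> aleph0} \<lesssim> {..<a (Suc 0)}" by (rule Pow_\<psi>)
  then have M: "{..<M} \<lesssim> {..<a (Suc 0)}"
    unfolding M_def by (rule lepoll_trans1[OF eqpoll_sym[OF eqpoll_cpow2]])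
  define T1 where "T1 = ds_below (csucc (csucc \<chi>))"
  have "tree T1" unfolding T1_def by (rule tree_ds_below)
  have "csucc (csucc \<chi>) \<le> cpow2 (cpow2 \<chi>)"
    using csucc_le_cpow2 cpow2_mono order_trans by blast
  then have "T1 \<lesssim> {..<cpow2 (cpow2 (cpow2 \<chi>))}"
    unfolding T1_def
    by (meson cpow2_mono ds_below_lepoll eqpoll_cpow2 lepoll_trans lepoll_trans2 lessThan_lepoll_mono)
  moreover have "cpow2 (cpow2 (cpow2 \<chi>)) < beth1 (Suc n) \<theta> \<mu>"
    using \<chi>[of 3] by (simp add: eval_nat_numeral \<psi>_def \<theta>'_def)
  ultimately have size: "ocard T1 < beth1 (Suc n) \<theta> \<mu>" "T1 \<lesssim> {..<beth1 (Suc n) \<theta> \<mu>}"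
    using eqpoll_ocard(2) order_le_less_trans lepoll_trans lessThan_lepoll_mono less_imp_le
    by metis+
  obtain e where e: "inj_on e {\<phi> :: nat \<times> nat \<Rightarrow> 'o. \<forall>p. \<phi> p < M}"
      "e ` {\<phi>. \<forall>p. \<phi> p < M} \<subseteq> {..<M}"
    using functions_lepoll_cpow2[OF inf_\<nu>] unfolding M_def lepoll_def by blast
  have "\<exists>f. lx2_embedding f S \<and> f ` S \<subseteq> T1 \<and> end_uniform (Suc n) c (f ` S)"
    if cM: "c \<in> Fpow T1 \<rightarrow> {..<M}" for c
  proof -
    interpret colouring T0 M \<chi> "\<lambda>k. a (Suc k)" c
    proof
      show "infinite {..<a (Suc 0)}"
        using \<psi>_inf lepoll_trans[OF lepoll_Pow_self Pow_\<psi>[OF lepoll_refl]] lepoll_trans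
        unfolding infinite_le_lepoll by blast
      show "Pow T0 \<lesssim> {..<a (Suc 0)}" by (rule Pow_\<psi>[OF lepoll_trans[OF T0(2) \<psi>(1)]])
      show "Pow {..<a (Suc k)} \<lesssim> {..<a (Suc (Suc k))}" for k
        unfolding a(2)[of "Suc k"] by (rule eqpoll_imp_lepoll[OF eqpoll_cpow2])
    qed (use T0(1) M a(3) cM in \<open>auto simp: T1_def\<close>)
    have T_eq: "colouring.T \<chi> = T1" by (simp add: T_def T1_def \<Theta>_def)
    obtain h where h: "lx2_embedding h T0" "h ` T0 \<subseteq> T1" "tail_uniform c {} h T0"
      "\<forall>\<rho>\<in>T0. \<forall>\<rho>'\<in>T0. length \<rho> = length \<rho>' \<longrightarrow> c {h \<rho>} = c {h \<rho>'}"
      using ex_tail_uniform_copy unfolding T_eq by blast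
    have colours: "extension_colours c h T0 u p < M" if "u \<in> Fpow T0" for u p
    proof -
      have "h ` insert (SOME \<rho>. extends_by T0 u p \<rho>) u \<in> Fpow T1"
        if "\<exists>\<rho>. extends_by T0 u p \<rho>"
      proof -
        have "extends_by T0 u p (SOME \<rho>. extends_by T0 u p \<rho>)" using that by (rule someI_ex)
        then have "(SOME \<rho>. extends_by T0 u p \<rho>) \<in> T0" by (cases p) (simp add: extends_by_def)
        then show ?thesis using \<open>u \<in> Fpow T0\<close> h(2) by (auto simp: Fpow_def)
      qed
      moreover have "{} \<in> Fpow T1" by (simp add: Fpow_def)
      ultimately show ?thesis using cM unfolding extension_colours_def by auto
    qed
    then have "(\<lambda>u. e (extension_colours c h T0 u)) \<in> Fpow T0 \<rightarrow> {..<M}"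
      using e(2) by blast
    from IH[OF this] obtain f where f: "lx2_embedding f S" "f ` S \<subseteq> T0"
      "end_uniform n (\<lambda>u. e (extension_colours c h T0 u)) (f ` S)" by blast
    have "end_uniform n (extension_colours c h T0) (f ` S)"
      unfolding end_uniform_def
    proof (intro allI impI)
      fix \<eta>s \<rho>s \<rho>s'
      assume *: "set \<eta>s \<subseteq> f ` S \<and> set \<rho>s \<subseteq> f ` S \<and> set \<rho>s' \<subseteq> f ` S \<and>
        length \<rho>s = n \<and> length \<rho>s' = n \<and>
        sorted_wrt lx2 (\<eta>s @ \<rho>s) \<and> sorted_wrt lx2 (\<eta>s @ \<rho>s') \<and>
        similar (\<eta>s @ \<rho>s) (\<eta>s @ \<rho>s')"
      then have "set (\<eta>s @ \<rho>s) \<in> Fpow T0" "set (\<eta>s @ \<rho>s') \<in> Fpow T0"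
        using f(2) by (auto simp: Fpow_def)
      moreover have "e (extension_colours c h T0 (set (\<eta>s @ \<rho>s))) =
          e (extension_colours c h T0 (set (\<eta>s @ \<rho>s')))"
        using f(3) * unfolding end_uniform_def by blast
      ultimately show "extension_colours c h T0 (set (\<eta>s @ \<rho>s)) =
          extension_colours c h T0 (set (\<eta>s @ \<rho>s'))"
        using colours by (intro inj_onD[OF e(1)]) auto
    qed
    then have "end_uniform (Suc n) c (h ` f ` S)"
      by (rule end_uniform_Suc[OF h(1,3,4) f(2)])
    moreover have "lx2_embedding (\<lambda>\<eta>. h (f \<eta>)) S" by (rule lx2_embedding_comp[OF f(1) h(1) f(2)])
    ultimately show ?thesis
      using f(2) h(2) by (intro exI[of _ "\<lambda>\<eta>. h (f \<eta>)"]) (auto simp: image_image)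
  qed
  then show ?case using \<open>tree T1\<close> size by blast
qed

theorem mainTheorem2:
  fixes S :: "'o::ordinals list set" and n :: nat and \<mu> :: 'o
  assumes "tree S" and "is_cardinal \<mu>"
  shows "\<exists>T :: 'o list set. tree T \<and>
    (\<forall>c \<in> Fpow T \<rightarrow> {..<\<mu>}.
       \<exists>S'. subtree S' T \<and> tree_isomorphic S S' \<and> end_uniform n c S') \<and>
    (\<forall>c \<in> nsets T n \<rightarrow> {..<\<mu>}.
       \<exists>S'. subtree S' T \<and> tree_isomorphic S S' \<and>
         (\<forall>u \<in> nsets S' n. \<forall>v \<in> nsets S' n. similar_sets u v \<longrightarrow> c u = c v)) \<and>
    (n > 0 \<longrightarrow> ocard T < beth1 n (max (ocard S) aleph0) \<mu>)"
proof -
  define \<theta> :: 'o where "\<theta> = max (ocard S) aleph0"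
  define M where "M = cpow2 (cadd \<mu> (aleph0::'o))"
  have "infinite {..<\<theta>}"
    using infinite_lessThan_aleph0 lessThan_lepoll_mono[of aleph0 \<theta>] lepoll_trans
    unfolding infinite_le_lepoll \<theta>_def by fastforce
  moreover have "S \<lesssim> {..<\<theta>}"
  proof -
    obtain \<alpha> :: 'o where "S \<lesssim> {..<\<alpha>}"
      using assms(1) by (auto simp: tree_def small_def)
    then have "S \<approx> {..<ocard S :: 'o}" by (rule eqpoll_ocard(1))
    then show ?thesis
      using lessThan_lepoll_mono[of "ocard S" \<theta>] lepoll_trans1 by (fastforce simp: \<theta>_def)
  qed
  ultimately obtain T where T: "tree T" "n > 0 \<longrightarrow> ocard T < beth1 n \<theta> \<mu>"
    and uniform: "\<And>c. c \<in> Fpow T \<rightarrow> {..<M} \<Longrightarrow>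
      \<exists>f. lx2_embedding f S \<and> f ` S \<subseteq> T \<and> end_uniform n c (f ` S)"
    using ex_end_uniform_tree[OF assms(1), of \<theta> n \<mu>] unfolding M_def by blast
  have copy: "\<exists>S'. subtree S' T \<and> tree_isomorphic S S' \<and> end_uniform n c S'"
    if "c \<in> Fpow T \<rightarrow> {..<M}" for c
  proof -
    obtain f where f: "lx2_embedding f S" "f ` S \<subseteq> T" "end_uniform n c (f ` S)"
      using uniform[OF \<open>c \<in> Fpow T \<rightarrow> {..<M}\<close>] by blast
    then show ?thesis
      using subtree_image[OF f(1,2) assms(1) T(1)] tree_isomorphic_image[OF f(1)] by blast
  qed
  have "\<mu> \<le> M"
  proof -
    have "{..<\<mu>} \<lesssim> {..<cadd \<mu> aleph0}" by (rule lepoll_cadd)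
    then have "Pow {..<\<mu>} \<lesssim> {..<M}"
      unfolding M_def by (rule lepoll_trans2[OF Pow_lepoll_mono eqpoll_cpow2])
    then show ?thesis by (intro less_imp_le less_if_Pow_lepoll)
  qed
  have "\<exists>S'. subtree S' T \<and> tree_isomorphic S S' \<and> end_uniform n c S'"
    if c: "c \<in> Fpow T \<rightarrow> {..<\<mu>}" for c
  proof (rule copy, rule Pi_I)
    show "c u \<in> {..<M}" if "u \<in> Fpow T" for u
      using c that \<open>\<mu> \<le> M\<close> order_less_le_trans by blast
  qed
  moreover have "\<exists>S'. subtree S' T \<and> tree_isomorphic S S' \<and>
         (\<forall>u \<in> nsets S' n. \<forall>v \<in> nsets S' n. similar_sets u v \<longrightarrow> c u = c v)"
    if c: "c \<in> nsets T n \<rightarrow> {..<\<mu>}" for c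
  proof -
    have "\<exists>x. x < M" using less_cpow2[of "cadd \<mu> (aleph0::'o)"] unfolding M_def by blast
    then obtain x where "x < M" ..
    \<comment> \<open>The bound \<open>M\<close> is positive even if \<open>\<mu>\<close> is zero, which leaves a colour for the other sets.\<close>
    define c' where "c' u = (if u \<in> nsets T n then c u else x)" for u
    have "c' \<in> Fpow T \<rightarrow> {..<M}"
    proof (rule Pi_I)
      have "c u < M" if "u \<in> nsets T n" for u
        using c that \<open>\<mu> \<le> M\<close> order_less_le_trans by blast
      then show "c' u \<in> {..<M}" for u using \<open>x < M\<close> by (simp add: c'_def)
    qed
    then obtain S' where S': "subtree S' T" "tree_isomorphic S S'" "end_uniform n c' S'"
      using copy by blast
    have "c u = c v" if u: "u \<in> nsets S' n" and v: "v \<in> nsets S' n" and "similar_sets u v" for u v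
    proof -
      have in_T: "u \<in> nsets T n" "v \<in> nsets T n"
        using u v S'(1) by (auto simp: nsets_def subtree_def)
      have listing: "sorted_wrt lx2 (lx2_list w)" "set (lx2_list w) = w" "length (lx2_list w) = n"
        if "w \<in> nsets S' n" for w
      proof -
        have w: "finite w" "card w = n" using that by (auto simp: nsets_def)
        show *: "sorted_wrt lx2 (lx2_list w)" "set (lx2_list w) = w" using lx2_list[OF w(1)] .
        show "length (lx2_list w) = n"
          using distinct_card[OF distinct_if_lx2_sorted[OF *(1)]] *(2) w(2) by simp
      qed
      have "c' (set ([] @ lx2_list u)) = c' (set ([] @ lx2_list v))"
        by (rule S'(3)[unfolded end_uniform_def, rule_format])
          (use listing[OF u] listing[OF v] u v \<open>similar_sets u v\<close> in
            \<open>auto simp: similar_sets_def nsets_def\<close>)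
      then show ?thesis
        using listing(2)[OF u] listing(2)[OF v] in_T by (simp add: c'_def)
    qed
    then show ?thesis using S' by blast
  qed
  ultimately show ?thesis
    using T unfolding \<theta>_def by (intro exI[of _ T]) blast
qed

end
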